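(* Let $R$ be a factorial domain, $K$ a field of quotients of $R$, $X$ an indeterminate over $K$, $f\in R[X]^{\bullet}$ and $L$ a quotient group of $[\![f]\!]$. For $g\in[\![f]\!]$ set $P_g=gK[X]\cap[\![f]\!]$. (1) $(P_gP_h)_v=P_{gh}$ for all $g,h\in[\![f]\!]$. (2) If $g\in[\![f]\!]\cap\mathcal{A}(K[X])$, then $\mathrm{v}_{P_g}(x[\![f]\!])=\mathrm{v}_g(x)$ for all $x\in L$. (3) If $g\in[\![f]\!]$, $Q\in\mathfrak{X}([\![f]\!])$ and $q\in Q\cap\mathcal{A}(R)$, then $\mathrm{v}_Q(g[\![f]\!])\leq\mathrm{v}_q(e_f(g))$.
   Context: Monoids are commutative and cancellative with identity; for a domain $D$, $D^{\bullet}=D\setminus\{0\}$ is a multiplicative monoid; $\mathcal{A}(\cdot)$ denotes the set of atoms. For a monoid $H$ with quotient group $L$: an $s$-ideal is a subset $I\subseteq H$ with $IH=I$ (the empty set is allowed); it is prime if $I\neq H$ and $H\setminus I$ is a submonoid. $\mathfrak{X}(H)$ is the set of minimal nonempty prime $s$-ideals of $H$. For $Y\subseteq L$ put $Y^{-1}=\{z\in L\mid zY\subseteq H\}$ and $Y_v=(Y^{-1})^{-1}$; $I$ is a $v$-ideal if $I_v=I$. If $H$ is a Krull monoid (completely integrally closed Mori monoid), every nonempty fractional $v$-ideal $I$ is uniquely a $v$-product $(\prod_{P\in\mathfrak{X}(H)}P^{\mathrm{v}_P(I)})_v$ with integers $\mathrm{v}_P(I)$, almost all zero; $\mathrm{v}_P(I)$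 is the $P$-adic exponent of $I$. ${\rm Int}(R)=\{g\in K[X]\mid g(x)\in R\text{ for all }x\in R\}$. For $f\in{\rm Int}(R)^{\bullet}$, $[\![f]\!]=\{g\in{\rm Int}(R)^{\bullet}\mid g\text{ divides }f^k\text{ in }{\rm Int}(R)\text{ for some }k\in\mathbb{N}_0\}$; it is known that $[\![f]\!]$ is a Krull monoid. If $g\in[\![f]\!]\cap\mathcal{A}(K[X])$, then $P_g\in\mathfrak{X}([\![f]\!])$. For $g\in\mathcal{A}(K[X])$, $\mathrm{v}_g$ is the $g$-adic valuation on $K(X)$; for $q\in\mathcal{A}(R)$, $\mathrm{v}_q$ is the $q$-adic valuation on $R$. Fix a system $\mathcal{Q}$ of representatives (up to associates) of the prime elements of $R$. Define $d:{\rm Int}(R)^{\bullet}\to R^{\bullet}$ by $d(g)=\prod_{p\in\mathcal{Q}}p^{\min\{\mathrm{v}_p(g(c))\mid c\in R\}}$, and $e_f:[\![f]\!]\to R^{\bullet}$ by $e_f(g)=\prod_{p\in\mathcal{Q}}p^{\max\{\mathrm{v}_p(d(gh)/d(h))\mid h\in[\![f]\!]\}}$ (a least common multiple in $R$ of $\{d(gh)/d(h)\mid h\in[\![f]\!]\}$; the maxima are finite and almost all zero). *)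

theory Defs
  imports
    "HOL-Computational_Algebra.Computational_Algebra"
    "HOL-Library.Set_Algebras"
    "HOL-Library.Extended_Nat"
begin

section \<open>Ideal theory of a cancellative monoid inside a field\<close>

text \<open>
  A monoid \<open>H\<close> is a multiplicatively closed subset of \<open>F - {0}\<close> containing \<open>1\<close>, for some field
  \<open>F\<close>; its quotient group is then realised inside \<open>F\<close>.  Products and powers of subsets are the
  elementwise ones of \<^theory>\<open>HOL-Library.Set_Algebras\<close>.
\<close>

definition quotient_group :: "'l::field set \<Rightarrow> 'l set" where
  "quotient_group H = {a / b | a b. a \<in> H \<and> b \<in> H}"

definition is_submonoid :: "'l::field set \<Rightarrow> 'l set \<Rightarrow> bool" where
  "is_submonoid H S \<longleftrightarrow> S \<subseteq> H \<and> 1 \<in> S \<and> (\<forall>x\<in>S. \<forall>y\<in>S. x * y \<in> S)"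

definition s_ideal :: "'l::field set \<Rightarrow> 'l set \<Rightarrow> bool" where
  "s_ideal H I \<longleftrightarrow> I \<subseteq> H \<and> I * H = I"

definition prime_s_ideal :: "'l::field set \<Rightarrow> 'l set \<Rightarrow> bool" where
  "prime_s_ideal H I \<longleftrightarrow> s_ideal H I \<and> I \<noteq> H \<and> is_submonoid H (H - I)"

definition min_primes :: "'l::field set \<Rightarrow> 'l set set" where
  "min_primes H = {P. prime_s_ideal H P \<and> P \<noteq> {} \<and>
     (\<forall>I. prime_s_ideal H I \<and> I \<noteq> {} \<and> I \<subseteq> P \<longrightarrow> I = P)}"

definition frac_inv :: "'l::field set \<Rightarrow> 'l set \<Rightarrow> 'l set" where
  "frac_inv H Y = {z \<in> quotient_group H. \<forall>y\<in>Y. z * y \<in> H}"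

definition v_closure :: "'l::field set \<Rightarrow> 'l set \<Rightarrow> 'l set" where
  "v_closure H Y = frac_inv H (frac_inv H Y)"

definition frac_power :: "'l::field set \<Rightarrow> 'l set \<Rightarrow> int \<Rightarrow> 'l set" where
  "frac_power H P k = (if k \<ge> 0 then P ^ nat k else frac_inv H P ^ nat (- k))"

text \<open>
  The exponents occurring in \<open>I = (\<Prod>\<^sub>P P ^ n P)\<^sub>v\<close>; the values of \<open>n\<close> outside \<open>min_primes H\<close> are
  pinned to \<open>0\<close> so that \<open>n\<close> is a unique function whenever the factorisation is unique.
\<close>

definition v_exponents :: "'l::field set \<Rightarrow> 'l set \<Rightarrow> ('l set \<Rightarrow> int) \<Rightarrow> bool" where
  "v_exponents H I n \<longleftrightarrow>
     finite {P. n P \<noteq> 0} \<and> {P. n P \<noteq> 0} \<subseteq> min_primes H \<and>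
     I = v_closure H (\<Prod>P | n P \<noteq> 0. frac_power H P (n P))"

definition v_exponent :: "'l::field set \<Rightarrow> 'l set \<Rightarrow> 'l set \<Rightarrow> int" where
  "v_exponent H P I = (THE n. v_exponents H I n) P"


section \<open>Valuations\<close>

text \<open>\<^const>\<open>multiplicity\<close> has the value \<open>0\<close> at \<open>0\<close>, whereas \<open>v\<^sub>p(0) = \<infinity>\<close>.\<close>

definition adic_val :: "'a::factorial_semiring \<Rightarrow> 'a \<Rightarrow> enat" where
  "adic_val p x = (if x = 0 then \<infinity> else enat (multiplicity p x))"

text \<open>
  The \<open>g\<close>-adic valuation on nonzero elements of \<open>K[X]\<close> and \<open>K(X)\<close>.  For an arbitrary field \<open>K\<close> the
  type of polynomials is not an instance of \<^class>\<open>factorial_semiring\<close>, so \<^const>\<open>multiplicity\<close> is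
  not available.
\<close>

definition poly_val :: "'k::field poly \<Rightarrow> 'k poly \<Rightarrow> nat" where
  "poly_val g a = Max {n. g ^ n dvd a}"

definition fract_val :: "'k::field poly \<Rightarrow> 'k poly fract \<Rightarrow> int" where
  "fract_val g x = (THE k. \<exists>a b. a \<noteq> 0 \<and> b \<noteq> 0 \<and> x = Fract a b \<and>
     k = int (poly_val g a) - int (poly_val g b))"


section \<open>Integer-valued polynomials\<close>

text \<open>The field \<open>'k\<close> is a field of quotients of \<open>'a\<close> via the embedding \<open>\<iota>\<close>.\<close>

definition quotient_field_embedding :: "('a::idom \<Rightarrow> 'k::field) \<Rightarrow> bool" where
  "quotient_field_embedding \<iota> \<longleftrightarrow>
     \<iota> 1 = 1 \<and> (\<forall>x y. \<iota> (x + y) = \<iota> x + \<iota> y) \<and> (\<forall>x y. \<iota> (x * y) = \<iota> x * \<iota> y) \<and> inj \<iota> \<and>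
     (\<forall>z. \<exists>a b. b \<noteq> 0 \<and> z = \<iota> a / \<iota> b)"

definition Int_poly :: "('a::idom \<Rightarrow> 'k::field) \<Rightarrow> 'k poly set" where
  "Int_poly \<iota> = {g. \<forall>x. poly g (\<iota> x) \<in> range \<iota>}"

text \<open>The divisor-closed submonoid of the nonzero integer-valued polynomials generated by \<open>f\<close>.\<close>

definition div_closed :: "('a::idom \<Rightarrow> 'k::field) \<Rightarrow> 'k poly \<Rightarrow> 'k poly set" where
  "div_closed \<iota> f =
     {g \<in> Int_poly \<iota> - {0}. \<exists>k. \<exists>h \<in> Int_poly \<iota>. f ^ k = g * h}"

text \<open>The same monoid, and the sets \<open>P\<^sub>g = g K[X] \<inter> [[f]]\<close>, as subsets of \<open>K(X)\<close>.\<close>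

definition div_monoid :: "('a::idom \<Rightarrow> 'k::field) \<Rightarrow> 'k poly \<Rightarrow> 'k poly fract set" where
  "div_monoid \<iota> f = to_fract ` div_closed \<iota> f"

definition P_ideal :: "('a::idom \<Rightarrow> 'k::field) \<Rightarrow> 'k poly \<Rightarrow> 'k poly \<Rightarrow> 'k poly fract set" where
  "P_ideal \<iota> f g = to_fract ` (range (\<lambda>u. g * u) \<inter> div_closed \<iota> f)"

definition prime_representatives :: "'a::comm_semiring_1 set \<Rightarrow> bool" where
  "prime_representatives \<Q> \<longleftrightarrow> (\<forall>p\<in>\<Q>. prime_elem p) \<and>
     (\<forall>p. prime_elem p \<longrightarrow> (\<exists>!r. r \<in> \<Q> \<and> r dvd p \<and> p dvd r))"

definition fin_prime_prod :: "'a::comm_semiring_1 set \<Rightarrow> ('a \<Rightarrow> nat) \<Rightarrow> 'a" where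
  "fin_prime_prod \<Q> k = (\<Prod>p | p \<in> \<Q> \<and> k p \<noteq> 0. p ^ k p)"

text \<open>
  For \<open>g \<noteq> 0\<close> the infimum is an attained finite minimum as soon as \<open>\<Q>\<close> is nonempty: then \<open>'a\<close> is
  not a field, hence infinite, and \<open>g\<close> has a nonroot in \<open>'a\<close>.
\<close>

definition fixed_div :: "('a::{factorial_semiring,idom} \<Rightarrow> 'k::field) \<Rightarrow> 'a set \<Rightarrow> 'k poly \<Rightarrow> 'a" where
  "fixed_div \<iota> \<Q> g =
     fin_prime_prod \<Q> (\<lambda>p. the_enat (INF c. adic_val p (inv \<iota> (poly g (\<iota> c)))))"

definition e_fun ::
  "('a::{factorial_semiring,idom} \<Rightarrow> 'k::field) \<Rightarrow> 'a set \<Rightarrow> 'k poly \<Rightarrow> 'k poly \<Rightarrow> 'a" where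
  "e_fun \<iota> \<Q> f g = fin_prime_prod \<Q> (\<lambda>p.
     Max {multiplicity p (fixed_div \<iota> \<Q> (g * h) div fixed_div \<iota> \<Q> h) | h. h \<in> div_closed \<iota> f})"

end

theory Submission
  imports Defs
begin

text \<open>
  Inside \<open>K(X)\<close> the monoid \<open>H = [[f]]\<close> is cut out of its quotient group \<open>L\<close> by finitely many
  normalized homomorphisms \<open>w : L \<rightarrow> \<int>\<close>: the \<open>g\<close>-adic valuations for the irreducible factors \<open>g\<close>
  of \<open>f\<close>, and the point valuations \<open>x \<mapsto> v\<^sub>p(x(c))\<close> for the finitely many primes \<open>p \<in> H\<close> of the
  ring.  For fixed \<open>p\<close> finitely many points \<open>c\<close> suffice, by Dickson's lemma applied to the vectors
  \<open>(v\<^sub>p(g(c)))\<^sub>g\<close>.  After discarding redundant homomorphisms, the minimal primes of \<open>H\<close> are the sets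
  \<open>{x \<in> H. w(x) > 0}\<close>, a subset of \<open>L\<close> has a \<open>v\<close>-closure that depends only on its minima under the
  \<open>w\<close>, and \<open>w(x)\<close> is the exponent of \<open>x H\<close> at the prime of \<open>w\<close>.

  The \<open>g\<close>-adic valuations are never redundant, because by Gauss's lemma \<open>H\<close> contains a primitive
  associate of \<open>g\<close>; this gives (1) and (2).  For (3) let \<open>Q\<close> be the prime of \<open>w = (x \<mapsto> v\<^sub>q(x(c)))\<close> and
  let \<open>h\<close> be a high power of an element with \<open>w(h) = 0\<close> on which all other \<open>w'\<close> are positive: then
  \<open>v\<^sub>q(d(h)) = 0\<close>, while the minimum of \<open>v\<^sub>q\<close> over the values of \<open>g h\<close> is \<open>w(g)\<close>.
\<close>

section \<open>Monoids defined by finitely many valuations\<close>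

locale finite_valuation_monoid =
  fixes H :: "'l::field set" and W :: "('l \<Rightarrow> int) set"
  assumes one_in: "1 \<in> H" and zero_notin: "0 \<notin> H"
    and mult_in: "x \<in> H \<Longrightarrow> y \<in> H \<Longrightarrow> x * y \<in> H"
    and finite_W: "finite W"
    and hom: "w \<in> W \<Longrightarrow> x \<in> quotient_group H \<Longrightarrow> y \<in> quotient_group H \<Longrightarrow> w (x * y) = w x + w y"
    and in_iff: "x \<in> quotient_group H \<Longrightarrow> x \<in> H \<longleftrightarrow> (\<forall>w\<in>W. 0 \<le> w x)"
    and normalized: "w \<in> W \<Longrightarrow> \<exists>x\<in>quotient_group H. w x = 1"
begin

abbreviation L where "L \<equiv> quotient_group H"

lemma H_subset_L: "x \<in> H \<Longrightarrow> x \<in> L"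
  unfolding quotient_group_def using one_in by (metis (mono_tags, lifting) div_by_1 mem_Collect_eq)

lemma L_nonzero: "x \<in> L \<Longrightarrow> x \<noteq> 0"
  unfolding quotient_group_def using zero_notin by auto

lemma one_in_L: "1 \<in> L"
  using H_subset_L one_in by blast

lemma L_mult: "x \<in> L \<Longrightarrow> y \<in> L \<Longrightarrow> x * y \<in> L"
  unfolding quotient_group_def using mult_in by (fastforce simp: times_divide_times_eq)

lemma L_inverse: "x \<in> L \<Longrightarrow> inverse x \<in> L"
  unfolding quotient_group_def by force

lemma L_power: "x \<in> L \<Longrightarrow> x ^ n \<in> L"
  by (induction n) (auto intro: L_mult one_in_L)

lemma H_power: "x \<in> H \<Longrightarrow> x ^ n \<in> H"
  by (induction n) (auto intro: mult_in one_in)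

lemma L_power_int: "x \<in> L \<Longrightarrow> x powi k \<in> L"
  by (cases k rule: int_cases2) (auto simp: power_int_minus intro: L_power L_inverse)

lemma val_one: "w \<in> W \<Longrightarrow> w 1 = 0"
  using hom[of w 1 1] one_in_L by simp

lemma val_inverse: "w \<in> W \<Longrightarrow> x \<in> L \<Longrightarrow> w (inverse x) = - w x"
  using hom[of w x "inverse x"] L_inverse L_nonzero val_one by fastforce

lemma val_power: "w \<in> W \<Longrightarrow> x \<in> L \<Longrightarrow> w (x ^ n) = int n * w x"
  by (induction n) (simp_all add: val_one hom L_power algebra_simps)

lemma val_power_int: "w \<in> W \<Longrightarrow> x \<in> L \<Longrightarrow> w (x powi k) = k * w x"
  by (cases k rule: int_cases2)
     (auto simp: power_int_minus val_power val_inverse L_power)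

lemma val_nonneg: "w \<in> W \<Longrightarrow> x \<in> H \<Longrightarrow> 0 \<le> w x"
  using in_iff H_subset_L by blast

lemma prod_in: "finite A \<Longrightarrow> (\<And>i. i \<in> A \<Longrightarrow> y i \<in> H) \<Longrightarrow> prod y A \<in> H"
  by (induction A rule: finite_induct) (auto intro: mult_in one_in)

lemma val_prod:
  assumes "finite A" "w \<in> W" "\<And>i. i \<in> A \<Longrightarrow> y i \<in> H"
  shows "w (prod y A) = (\<Sum>i\<in>A. w (y i))"
  using assms by (induction A rule: finite_induct) (auto simp: val_one hom H_subset_L prod_in)

text \<open>An element of value 1 is a quotient of two elements of the monoid, so its numerator is
  positive at \<open>w\<close>. Multiplying such numerators over all \<open>w\<close> preserves
  this, since no factor has a negative value.\<close>

lemma ex_all_positive: "\<exists>z\<in>H. \<forall>w\<in>W. 0 < w z"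
proof -
  have "\<exists>a\<in>H. 0 < w a" if w: "w \<in> W" for w
  proof -
    obtain x where x: "x \<in> L" "w x = 1" using normalized[OF w] by blast
    then obtain a b where ab: "a \<in> H" "b \<in> H" "x = a / b" unfolding quotient_group_def by blast
    then have "w a = w x + w b"
      using hom[OF w x(1) H_subset_L[OF ab(2)]] zero_notin by (cases "b = 0") auto
    with x val_nonneg[OF w ab(2)] ab(1) show ?thesis by (intro bexI[of _ a]) auto
  qed
  then obtain a where a: "\<And>w. w \<in> W \<Longrightarrow> a w \<in> H \<and> 0 < w (a w)" by metis
  have "0 < w (prod a W)" if w: "w \<in> W" for w
    using w a by (auto simp: val_prod[OF finite_W w] intro!: sum_pos2[OF finite_W w] val_nonneg)
  with a show ?thesis by (intro bexI[of _ "prod a W"]) (auto intro: prod_in finite_W)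
qed

text \<open>Among the finitely many subfamilies that still cut out the monoid a minimal one is
  taken. Deleting a further \<open>w\<close> must let in new elements, and these are negative at
  \<open>w\<close> and nonnegative at the others.\<close>

lemma exists_irredundant:
  "\<exists>V\<subseteq>W. (\<forall>x\<in>L. x \<in> H \<longleftrightarrow> (\<forall>w\<in>V. 0 \<le> w x)) \<and>
     (\<forall>w\<in>V. \<exists>x\<in>L. w x < 0 \<and> (\<forall>w'\<in>V - {w}. 0 \<le> w' x))"
proof -
  define S where "S = {V. V \<subseteq> W \<and> (\<forall>x\<in>L. x \<in> H \<longleftrightarrow> (\<forall>w\<in>V. 0 \<le> w x))}"
  have "finite S" unfolding S_def using finite_W by simp
  moreover have "S \<noteq> {}" unfolding S_def using in_iff by blast
  ultimately obtain V where V: "V \<in> S" and min: "\<And>U. U \<in> S \<Longrightarrow> U \<subseteq> V \<Longrightarrow> V = U"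
    using finite_has_minimal[of S] by metis
  have Viff: "x \<in> H \<longleftrightarrow> (\<forall>w\<in>V. 0 \<le> w x)" if "x \<in> L" for x
    using V that unfolding S_def by auto
  have "\<exists>x\<in>L. w x < 0 \<and> (\<forall>w'\<in>V - {w}. 0 \<le> w' x)" if w: "w \<in> V" for w
  proof -
    have "V - {w} \<notin> S" using min[of "V - {w}"] w by blast
    moreover have "V - {w} \<subseteq> W" using V unfolding S_def by blast
    ultimately obtain x where x: "x \<in> L" "(x \<in> H) \<noteq> (\<forall>w'\<in>V - {w}. 0 \<le> w' x)"
      unfolding S_def by blast
    then have *: "x \<notin> H" "\<forall>w'\<in>V - {w}. 0 \<le> w' x" using Viff[OF x(1)] by auto
    then have "w x < 0" using Viff[OF x(1)] by (metis DiffI not_le singletonD)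
    with * x(1) show ?thesis by blast
  qed
  with Viff V show ?thesis unfolding S_def by blast
qed

end

section \<open>Approximation for an irredundant family of valuations\<close>

locale finite_krull_monoid = finite_valuation_monoid +
  assumes irredundant: "w \<in> W \<Longrightarrow> \<exists>x\<in>quotient_group H. w x < 0 \<and> (\<forall>w'\<in>W - {w}. 0 \<le> w' x)"
begin

text \<open>A witness of irredundancy, negative only at \<open>w\<close>, is balanced against an
  everywhere positive element.\<close>

lemma separating_element:
  assumes w: "w \<in> W"
  shows "\<exists>y\<in>H. w y = 0 \<and> (\<forall>w'\<in>W - {w}. 0 < w' y)"
proof -
  obtain x where x: "x \<in> L" "w x < 0" "\<And>w'. w' \<in> W - {w} \<Longrightarrow> 0 \<le> w' x"
    using irredundant[OF w] by blast
  obtain z where z: "z \<in> H" "\<And>w. w \<in> W \<Longrightarrow> 0 < w z" using ex_all_positive by blast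
  \<comment> \<open>The two contributions to \<open>w y\<close> cancel. Both exponents are positive,
    so \<open>nat\<close> loses nothing, and the power of \<open>z\<close> makes all other values
    strictly positive.\<close>
  define y where "y = x ^ nat (w z) * z ^ nat (- w x)"
  have zL: "z \<in> L" using z H_subset_L by blast
  have yL: "y \<in> L" unfolding y_def using x zL by (intro L_mult L_power)
  have wy: "w' y = int (nat (w z)) * w' x + int (nat (- w x)) * w' z" if "w' \<in> W" for w'
    unfolding y_def using that x zL by (simp add: hom L_power val_power)
  have "w y = 0" using wy[OF w] x z(2)[OF w] by simp
  moreover have pos: "0 < w' y" if "w' \<in> W - {w}" for w'
  proof -
    have "0 \<le> int (nat (w z)) * w' x" using x(3)[OF that] by simp
    moreover have "0 < int (nat (- w x)) * w' z" using x(2) z(2) that by (intro mult_pos_pos) auto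
    ultimately show ?thesis using wy[of w'] that by (metis DiffD1 add_nonneg_pos)
  qed
  ultimately have "y \<in> H" using yL in_iff[OF yL] by (metis DiffI order.refl order.strict_implies_order singletonD)
  with \<open>w y = 0\<close> pos show ?thesis by blast
qed

text \<open>A power of an element of value 1 prescribes the value at \<open>w\<close>. A high power
  of a separating element leaves this value alone and raises the others past their bounds.\<close>

lemma approximation:
  assumes w: "w \<in> W"
  shows "\<exists>x\<in>L. w x = n w \<and> (\<forall>w'\<in>W. n w' \<le> w' x)"
proof -
  obtain t where t: "t \<in> L" "w t = 1" using normalized[OF w] by blast
  obtain y where y: "y \<in> H" "w y = 0" "\<And>w'. w' \<in> W - {w} \<Longrightarrow> 0 < w' y"
    using separating_element[OF w] by blast
  define s where "s = t powi n w"
  \<comment> \<open>The sum dominates every single deficit, and the other values of \<open>y\<close>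
    are at least 1.\<close>
  define N where "N = nat (\<Sum>w'\<in>W. \<bar>n w' - w' s\<bar>)"
  have sL: "s \<in> L" unfolding s_def using t by (intro L_power_int)
  have yL: "y \<in> L" using y H_subset_L by blast
  have val: "w' (s * y ^ N) = w' s + int N * w' y" if "w' \<in> W" for w'
    using that sL yL by (simp add: hom L_power val_power)
  have ws: "w s = n w" unfolding s_def using val_power_int[OF w t(1)] t(2) by simp
  have "n w' \<le> w' (s * y ^ N)" if w': "w' \<in> W" for w'
  proof (cases "w' = w")
    case True
    then show ?thesis using val[OF w] ws y(2) by simp
  next
    case False
    then have "1 \<le> w' y" using y(3) w' by force
    then have "int N \<le> int N * w' y" by (simp add: mult_le_cancel_left1)
    moreover have "\<bar>n w' - w' s\<bar> \<le> int N"
      unfolding N_def using member_le_sum[OF w' _ finite_W, of "\<lambda>w'. \<bar>n w' - w' s\<bar>"]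
      by (simp add: sum_nonneg)
    ultimately show ?thesis using val[OF w'] by linarith
  qed
  moreover have "w (s * y ^ N) = n w" using val[OF w] ws y(2) by simp
  moreover have "s * y ^ N \<in> L" using sL yL by (intro L_mult L_power)
  ultimately show ?thesis by blast
qed

section \<open>Fractional v-ideals and their exponent vectors\<close>

definition div_ideal :: "(('a \<Rightarrow> int) \<Rightarrow> int) \<Rightarrow> 'a set" where
  "div_ideal n = {x \<in> L. \<forall>w\<in>W. n w \<le> w x}"

text \<open>The vector \<open>n\<close> consists of minima of the valuations on \<open>Y\<close>;
  different valuations may reach theirs at different elements. For such \<open>Y\<close> the inverse
  and the \<open>v\<close>-closure depend on these minima only.\<close>

definition attains :: "'a set \<Rightarrow> (('a \<Rightarrow> int) \<Rightarrow> int) \<Rightarrow> bool" where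
  "attains Y n \<longleftrightarrow> Y \<subseteq> L \<and> (\<forall>w\<in>W. (\<forall>y\<in>Y. n w \<le> w y) \<and> (\<exists>y\<in>Y. w y = n w))"

text \<open>By approximation no bound is slack. Hence vectors that differ on \<open>W\<close> give
  different ideals: the divisor group is free on \<open>W\<close>.\<close>

lemma attains_div_ideal: "attains (div_ideal n) n"
  unfolding attains_def div_ideal_def using approximation[of _ n] by blast

lemma attains_unique: "attains Y n \<Longrightarrow> attains Y m \<Longrightarrow> w \<in> W \<Longrightarrow> n w = m w"
  unfolding attains_def by (metis order_antisym)

lemma attains_cong: "attains Y n \<Longrightarrow> (\<And>w. w \<in> W \<Longrightarrow> n w = m w) \<Longrightarrow> attains Y m"
  unfolding attains_def by auto

lemma div_ideal_cong: "(\<And>w. w \<in> W \<Longrightarrow> n w = m w) \<Longrightarrow> div_ideal n = div_ideal m"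
  unfolding div_ideal_def by auto

lemma div_ideal_eq_iff: "div_ideal n = div_ideal m \<longleftrightarrow> (\<forall>w\<in>W. n w = m w)"
  using attains_unique[OF attains_div_ideal] attains_div_ideal[of m] div_ideal_cong by metis

text \<open>The condition \<open>0 \<le> w z + w y\<close> only has to be tested at an element
  \<open>y\<close> where \<open>w\<close> is minimal.\<close>

lemma frac_inv_attains:
  assumes Y: "attains Y n"
  shows "frac_inv H Y = div_ideal (\<lambda>w. - n w)"
proof -
  have "(\<forall>y\<in>Y. z * y \<in> H) \<longleftrightarrow> (\<forall>w\<in>W. - n w \<le> w z)" if z: "z \<in> L" for z
  proof -
    have "z * y \<in> H \<longleftrightarrow> (\<forall>w\<in>W. 0 \<le> w z + w y)" if "y \<in> Y" for y
    proof -
      have y: "y \<in> L" using Y that unfolding attains_def by blast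
      show ?thesis using in_iff[OF L_mult[OF z y]] hom[OF _ z y] by auto
    qed
    then have "(\<forall>y\<in>Y. z * y \<in> H) \<longleftrightarrow> (\<forall>w\<in>W. \<forall>y\<in>Y. 0 \<le> w z + w y)" by blast
    also have "\<dots> \<longleftrightarrow> (\<forall>w\<in>W. - n w \<le> w z)"
    proof (intro ball_cong refl)
      fix w assume "w \<in> W"
      then have "\<forall>y\<in>Y. n w \<le> w y" "\<exists>y\<in>Y. w y = n w" using Y unfolding attains_def by auto
      then show "(\<forall>y\<in>Y. 0 \<le> w z + w y) \<longleftrightarrow> - n w \<le> w z" by force
    qed
    finally show ?thesis .
  qed
  then show ?thesis unfolding frac_inv_def div_ideal_def by auto
qed

lemma v_closure_attains: "attains Y n \<Longrightarrow> v_closure H Y = div_ideal n"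
  unfolding v_closure_def
  by (simp add: frac_inv_attains frac_inv_attains[OF attains_div_ideal])

lemma attains_one: "attains 1 (\<lambda>_. 0)"
  unfolding attains_def using one_in_L by (simp add: val_one)

lemma attains_mult:
  assumes "attains Y n" "attains Z m"
  shows "attains (Y * Z) (\<lambda>w. n w + m w)"
proof -
  have "n w + m w \<le> w x" if w: "w \<in> W" and x: "x \<in> Y * Z" for w x
  proof -
    obtain y z where yz: "y \<in> Y" "z \<in> Z" "x = y * z" using x by (auto elim: set_times_elim)
    then have "y \<in> L" "z \<in> L" using assms unfolding attains_def by auto
    moreover have "n w \<le> w y" "m w \<le> w z" using assms yz w unfolding attains_def by auto
    ultimately show ?thesis using hom[OF w] yz by simp
  qed
  moreover have "\<exists>x\<in>Y * Z. w x = n w + m w" if w: "w \<in> W" for w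
  proof -
    obtain y z where yz: "y \<in> Y" "w y = n w" "z \<in> Z" "w z = m w"
      using assms w unfolding attains_def by meson
    moreover from this have "y \<in> L" "z \<in> L" using assms unfolding attains_def by auto
    ultimately show ?thesis using hom[OF w, of y z] by (metis set_times_intro)
  qed
  moreover have "Y * Z \<subseteq> L"
    using assms unfolding attains_def by (auto elim!: set_times_elim intro!: L_mult)
  ultimately show ?thesis unfolding attains_def by blast
qed

lemma attains_power: "attains Y n \<Longrightarrow> attains (Y ^ k) (\<lambda>w. int k * n w)"
proof (induction k)
  case 0
  then show ?case using attains_one by simp
next
  case (Suc k)
  then show ?case using attains_mult[OF Suc.prems Suc.IH] by (simp add: algebra_simps)
qed

lemma attains_prod:
  assumes "finite A" "\<And>i. i \<in> A \<Longrightarrow> attains (Y i) (n i)"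
  shows "attains (prod Y A) (\<lambda>w. \<Sum>i\<in>A. n i w)"
  using assms by (induction A rule: finite_induct) (auto simp del: set_one intro: attains_one attains_mult)

lemma attains_principal:
  assumes "x \<in> L"
  shows "attains ({x} * H) (\<lambda>w. w x)"
proof -
  have "w y \<ge> w x" if "w \<in> W" "y \<in> {x} * H" for w y
    using that assms hom[OF that(1) assms] val_nonneg[OF that(1)] H_subset_L
    by (auto elim!: set_times_elim)
  moreover have "x \<in> {x} * H" using one_in set_times_intro[of x "{x}" 1 H] by simp
  moreover have "{x} * H \<subseteq> L" using assms by (auto elim!: set_times_elim intro: L_mult H_subset_L)
  ultimately show ?thesis unfolding attains_def by blast
qed

lemma principal_eq_div_ideal:
  assumes x: "x \<in> L"
  shows "{x} * H = div_ideal (\<lambda>w. w x)"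
proof
  show "{x} * H \<subseteq> div_ideal (\<lambda>w. w x)"
    using attains_principal[OF x] unfolding attains_def div_ideal_def by blast
  show "div_ideal (\<lambda>w. w x) \<subseteq> {x} * H"
  proof
    fix y assume y: "y \<in> div_ideal (\<lambda>w. w x)"
    have yL: "y \<in> L" and le: "\<And>w. w \<in> W \<Longrightarrow> w x \<le> w y" using y unfolding div_ideal_def by auto
    have zL: "inverse x * y \<in> L" using x yL by (intro L_mult L_inverse)
    have "inverse x * y \<in> H"
      by (simp add: in_iff[OF zL] hom[OF _ L_inverse[OF x] yL] val_inverse[OF _ x] le)
    then have "x * (inverse x * y) \<in> {x} * H" by (intro set_times_intro) auto
    then show "y \<in> {x} * H" using L_nonzero[OF x] by (simp add: mult.assoc[symmetric])
  qed
qed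

section \<open>Minimal primes as primes of valuations\<close>

definition val_prime :: "('a \<Rightarrow> int) \<Rightarrow> 'a set" where
  "val_prime w = {x \<in> H. 0 < w x}"

lemma val_prime_eq_div_ideal:
  assumes w: "w \<in> W"
  shows "val_prime w = div_ideal (\<lambda>w'. if w' = w then 1 else 0)"
  unfolding val_prime_def div_ideal_def using in_iff w H_subset_L by (fastforce split: if_splits)

lemma attains_val_prime: "w \<in> W \<Longrightarrow> attains (val_prime w) (\<lambda>w'. if w' = w then 1 else 0)"
  by (simp add: val_prime_eq_div_ideal attains_div_ideal)

text \<open>The separating element of \<open>w'\<close> lies in the prime of every other valuation
  but not in that of \<open>w'\<close>, so these primes are pairwise incomparable.\<close>

lemma val_prime_inject:
  assumes "w \<in> W" "w' \<in> W" "val_prime w \<subseteq> val_prime w'"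
  shows "w = w'"
proof (rule ccontr)
  assume "w \<noteq> w'"
  moreover obtain y where "y \<in> H" "w' y = 0" "\<forall>v\<in>W - {w'}. 0 < v y"
    using separating_element[OF assms(2)] by blast
  ultimately show False using assms unfolding val_prime_def by force
qed

lemma prime_s_ideal_val_prime:
  assumes w: "w \<in> W"
  shows "prime_s_ideal H (val_prime w)" "val_prime w \<noteq> {}"
proof -
  have "val_prime w * H \<subseteq> val_prime w"
    using val_nonneg[OF w] hom[OF w] H_subset_L mult_in
    by (auto simp: val_prime_def elim!: set_times_elim) (metis add_pos_nonneg)
  moreover have "val_prime w \<subseteq> val_prime w * H" 
    using one_in by (metis mult.right_neutral set_times_intro subsetI)
  moreover have "1 \<notin> val_prime w" using val_one[OF w] by (simp add: val_prime_def)
  ultimately show "prime_s_ideal H (val_prime w)"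
    unfolding prime_s_ideal_def s_ideal_def is_submonoid_def using one_in
  proof (intro conjI ballI)
    fix x y assume xy: "x \<in> H - val_prime w" "y \<in> H - val_prime w"
    then have "w x = 0" "w y = 0" using val_nonneg[OF w] by (force simp: val_prime_def)+
    then show "x * y \<in> H - val_prime w"
      using xy hom[OF w, of x y] mult_in H_subset_L by (auto simp: val_prime_def)
  qed (auto simp: val_prime_def)
  show "val_prime w \<noteq> {}"
    using ex_all_positive w by (auto simp: val_prime_def)
qed

text \<open>Otherwise the complement of \<open>P\<close> contains for each \<open>w\<close> an
  element positive there, hence also their product. A high power of this product is divisible by a
  given element \<open>a\<close> of \<open>P\<close>, so it lies both in \<open>P\<close> and in the
  complement.\<close>

lemma prime_contains_val_prime:
  assumes P: "prime_s_ideal H P" "P \<noteq> {}"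
  shows "\<exists>w\<in>W. val_prime w \<subseteq> P"
proof (rule ccontr)
  assume "\<not> ?thesis"
  then have "\<forall>w\<in>W. \<exists>y\<in>H. 0 < w y \<and> y \<in> H - P" by (auto simp: val_prime_def)
  then obtain y where y: "\<And>w. w \<in> W \<Longrightarrow> 0 < w (y w) \<and> y w \<in> H - P" by metis
  have comp: "1 \<in> H - P" "\<And>a b. a \<in> H - P \<Longrightarrow> b \<in> H - P \<Longrightarrow> a * b \<in> H - P"
    using P unfolding prime_s_ideal_def is_submonoid_def by auto
  have "prod y A \<in> H - P" if "finite A" "A \<subseteq> W" for A
    using that comp y by (induction A rule: finite_induct) auto
  then have z: "prod y W \<in> H - P" using finite_W by blast
  then have zp: "prod y W ^ n \<in> H - P" for n using comp by (induction n) auto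
  have zpos: "1 \<le> w (prod y W)" if w: "w \<in> W" for w
  proof -
    have "0 < (\<Sum>i\<in>W. w (y i))"
      using w y val_nonneg[OF w] by (intro sum_pos2[OF finite_W w]) auto
    then show ?thesis using val_prod[OF finite_W w, of y] y by simp
  qed
  obtain a where a: "a \<in> P" "a \<in> H" using P unfolding prime_s_ideal_def s_ideal_def by blast
  have aL: "a \<in> L" and zL: "prod y W \<in> L" using a z H_subset_L by auto
  define N where "N = nat (\<Sum>w\<in>W. w a)"
  define b where "b = prod y W ^ N * inverse a"
  have bL: "b \<in> L" unfolding b_def using aL zL by (intro L_mult L_power L_inverse)
  have "0 \<le> w b" if w: "w \<in> W" for w
  proof -
    have "w a \<le> int N" unfolding N_def
      using member_le_sum[OF w _ finite_W, of "\<lambda>w. w a"] val_nonneg a(2) by (simp add: sum_nonneg)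
    moreover have "int N \<le> int N * w (prod y W)"
      using zpos[OF w] by (simp add: mult_le_cancel_left1)
    moreover have "w b = int N * w (prod y W) - w a"
      unfolding b_def using w aL zL by (simp add: hom L_power L_inverse val_power val_inverse)
    ultimately show ?thesis by simp
  qed
  then have "b \<in> H" using in_iff[OF bL] by blast
  then have "a * b \<in> P * H" using a by blast
  then have "a * b \<in> P" using P unfolding prime_s_ideal_def s_ideal_def by simp
  moreover have "a * b = prod y W ^ N" unfolding b_def using L_nonzero[OF aL] by simp
  ultimately show False using zp by simp
qed

lemma min_primes_eq: "min_primes H = val_prime ` W"
proof (intro set_eqI iffI)
  fix P assume "P \<in> min_primes H"
  then have P: "prime_s_ideal H P" "P \<noteq> {}"
      and min: "\<And>I. prime_s_ideal H I \<Longrightarrow> I \<noteq> {} \<Longrightarrow> I \<subseteq> P \<Longrightarrow> I = P"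
    unfolding min_primes_def by auto
  obtain w where w: "w \<in> W" "val_prime w \<subseteq> P" using prime_contains_val_prime[OF P] by blast
  then have "val_prime w = P" using min prime_s_ideal_val_prime[OF w(1)] by simp
  then show "P \<in> val_prime ` W" using w(1) by blast
next
  fix P assume "P \<in> val_prime ` W"
  then obtain w where w: "w \<in> W" "P = val_prime w" by blast
  have "I = val_prime w" if "prime_s_ideal H I" "I \<noteq> {}" "I \<subseteq> val_prime w" for I
  proof -
    obtain w' where w': "w' \<in> W" "val_prime w' \<subseteq> I"
      using prime_contains_val_prime \<open>prime_s_ideal H I\<close> \<open>I \<noteq> {}\<close> by blast
    then have "w' = w" using val_prime_inject w(1) \<open>I \<subseteq> val_prime w\<close> by blast
    with w' that show ?thesis by blast
  qed
  then show "P \<in> min_primes H"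
    using w prime_s_ideal_val_prime[OF w(1)] unfolding min_primes_def by blast
qed

section \<open>Exponents of v-products\<close>

lemma attains_frac_power:
  assumes w: "w \<in> W"
  shows "attains (frac_power H (val_prime w) k) (\<lambda>w'. if w' = w then k else 0)"
proof (cases "k \<ge> 0")
  case True
  then show ?thesis unfolding frac_power_def
    using attains_power[OF attains_val_prime[OF w], of "nat k"]
    by (auto elim: attains_cong)
next
  case False
  then show ?thesis unfolding frac_power_def frac_inv_attains[OF attains_val_prime[OF w]]
    using attains_power[OF attains_div_ideal, of "\<lambda>w'. - (if w' = w then 1 else 0)" "nat (- k)"]
    by (auto elim: attains_cong)
qed

text \<open>The \<open>v\<close>-product with exponents \<open>n\<close> is the divisorial ideal
  whose vector has the entry \<open>n (val_prime w)\<close> at \<open>w\<close>, and an ideal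
  determines its vector. So the factorisation exists and is unique, which gives the
  \<open>THE\<close> in \<open>v_exponent\<close> its meaning.\<close>

lemma v_exponents_div_ideal_iff:
  "v_exponents H (div_ideal m) n \<longleftrightarrow>
     (\<forall>w\<in>W. n (val_prime w) = m w) \<and> (\<forall>P. P \<notin> val_prime ` W \<longrightarrow> n P = 0)"
proof (cases "{P. n P \<noteq> 0} \<subseteq> val_prime ` W")
  case True
  then have fin: "finite {P. n P \<noteq> 0}" using finite_W finite_surj by blast
  have "attains (\<Prod>P | n P \<noteq> 0. frac_power H P (n P))
          (\<lambda>w. \<Sum>P | n P \<noteq> 0. if P = val_prime w then n P else 0)"
  proof (intro attains_prod[OF fin])
    fix P assume "P \<in> {P. n P \<noteq> 0}"
    then obtain w where w: "w \<in> W" "P = val_prime w" using True by blast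
    show "attains (frac_power H P (n P)) (\<lambda>w. if P = val_prime w then n P else 0)"
      by (rule attains_cong[OF attains_frac_power[OF w(1), of "n P", folded w(2)]])
         (use w val_prime_inject[of w] in auto)
  qed
  moreover have "(\<Sum>P | n P \<noteq> 0. if P = val_prime w then n P else 0) = n (val_prime w)" for w
    using fin by (simp add: sum.delta)
  ultimately have "v_closure H (\<Prod>P | n P \<noteq> 0. frac_power H P (n P))
      = div_ideal (\<lambda>w. n (val_prime w))"
    by (simp add: v_closure_attains)
  then show ?thesis
    unfolding v_exponents_def min_primes_eq using fin True div_ideal_eq_iff by auto
next
  case False
  then show ?thesis unfolding v_exponents_def min_primes_eq by blast
qed

lemma v_exponent_principal:
  assumes w: "w \<in> W" and x: "x \<in> L"
  shows "v_exponent H (val_prime w) ({x} * H) = w x"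
proof -
  \<comment> \<open>The values \<open>w x\<close> are carried over to the primes along the bijection
    \<open>val_prime\<close>; outside the minimal primes \<open>v_exponents\<close> forces
    0.\<close>
  define n where "n P = (if P \<in> val_prime ` W then the_inv_into W val_prime P x else 0)" for P
  have "inj_on val_prime W" using val_prime_inject by (auto intro: inj_onI)
  then have n: "n (val_prime v) = v x" if "v \<in> W" for v
    using that by (simp add: n_def the_inv_into_f_f)
  have "(THE n. v_exponents H ({x} * H) n) = n"
  proof (rule the_equality)
    show "v_exponents H ({x} * H) n"
      unfolding principal_eq_div_ideal[OF x] v_exponents_div_ideal_iff using n by (auto simp: n_def)
    fix m assume "v_exponents H ({x} * H) m"
    then show "m = n"
      unfolding principal_eq_div_ideal[OF x] v_exponents_div_ideal_iff
      using n by (intro ext) (metis imageE n_def)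
  qed
  then show ?thesis unfolding v_exponent_def using n[OF w] by simp
qed

end

lemma (in finite_valuation_monoid) exists_finite_krull_monoid: "\<exists>V\<subseteq>W. finite_krull_monoid H V"
proof -
  obtain V where V: "V \<subseteq> W" "\<And>x. x \<in> L \<Longrightarrow> x \<in> H \<longleftrightarrow> (\<forall>w\<in>V. 0 \<le> w x)"
    "\<And>w. w \<in> V \<Longrightarrow> \<exists>x\<in>L. w x < 0 \<and> (\<forall>w'\<in>V - {w}. 0 \<le> w' x)"
    using exists_irredundant by metis
  have "finite_krull_monoid H V"
  proof
    show "finite V" using V(1) finite_W finite_subset by blast
    show "w (x * y) = w x + w y" if "w \<in> V" "x \<in> L" "y \<in> L" for w x y
      using hom V(1) that by blast
    show "\<exists>x\<in>L. w x = 1" if "w \<in> V" for w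
      using normalized V(1) that by blast
  qed (fact one_in zero_notin mult_in V(2,3))+
  with V(1) show ?thesis by blast
qed

text \<open>Induction on the index set. Let \<open>T\<close> be a finite set for the coordinates
  other than \<open>j\<close>, and let \<open>N\<close> bound coordinate \<open>j\<close> on
  \<open>T\<close>. Then \<open>T\<close> also serves every point whose coordinate \<open>j\<close>
  exceeds \<open>N\<close>. The other points fall into finitely many layers of constant coordinate
  \<open>j\<close>, each with a finite set of its own by induction.\<close>

lemma dickson:
  fixes \<phi> :: "'i \<Rightarrow> 'c \<Rightarrow> nat"
  assumes "finite I"
  shows "\<exists>T\<subseteq>C. finite T \<and> (\<forall>c\<in>C. \<exists>t\<in>T. \<forall>i\<in>I. \<phi> i t \<le> \<phi> i c)"
  using assms
proof (induction I arbitrary: C rule: finite_induct)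
  case empty
  show ?case
  proof (cases "C = {}")
    case False
    then obtain c where "c \<in> C" by blast
    then show ?thesis by (intro exI[of _ "{c}"]) auto
  qed auto
next
  case (insert j I)
  obtain T where T: "T \<subseteq> C" "finite T" "\<And>c. c \<in> C \<Longrightarrow> \<exists>t\<in>T. \<forall>i\<in>I. \<phi> i t \<le> \<phi> i c"
    using insert.IH[of C] by metis
  obtain N where N: "\<And>t. t \<in> T \<Longrightarrow> \<phi> j t \<le> N"
    using finite_imageI[OF T(2), of "\<phi> j"] by (meson finite_nat_set_iff_bounded_le imageI)
  have "\<forall>k. \<exists>T\<subseteq>{c\<in>C. \<phi> j c = k}. finite T \<and>
      (\<forall>c\<in>{c\<in>C. \<phi> j c = k}. \<exists>t\<in>T. \<forall>i\<in>I. \<phi> i t \<le> \<phi> i c)"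
    using insert.IH by blast
  from choice[OF this] obtain U where U:
    "\<forall>k. U k \<subseteq> {c\<in>C. \<phi> j c = k} \<and> finite (U k) \<and>
      (\<forall>c\<in>{c\<in>C. \<phi> j c = k}. \<exists>t\<in>U k. \<forall>i\<in>I. \<phi> i t \<le> \<phi> i c)"
    by blast
  have "\<exists>t\<in>T \<union> (\<Union>k\<le>N. U k). \<forall>i\<in>insert j I. \<phi> i t \<le> \<phi> i c" if c: "c \<in> C" for c
  proof (cases "\<phi> j c \<le> N")
    case True
    obtain t where "t \<in> U (\<phi> j c)" "\<forall>i\<in>I. \<phi> i t \<le> \<phi> i c"
      using U[rule_format, of "\<phi> j c"] c by blast
    moreover have "\<phi> j t = \<phi> j c"
      using calculation U[rule_format, of "\<phi> j c"] by blast
    ultimately show ?thesis using True by (intro bexI[of _ t]) auto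
  next
    case False
    obtain t where t: "t \<in> T" "\<forall>i\<in>I. \<phi> i t \<le> \<phi> i c" using T(3)[OF c] by blast
    then have "\<phi> j t \<le> \<phi> j c" using N[OF t(1)] False by simp
    with t show ?thesis by (intro bexI[of _ t]) auto
  qed
  moreover have "T \<union> (\<Union>k\<le>N. U k) \<subseteq> C" using T(1) U by fast
  moreover have "finite (T \<union> (\<Union>k\<le>N. U k))" using T(2) U by simp
  ultimately show ?case by (intro exI[of _ "T \<union> (\<Union>k\<le>N. U k)"] conjI ballI)
qed

section \<open>The valuation of an irreducible polynomial\<close>

lemma irreducible_poly_not_unit: "irreducible g \<Longrightarrow> g \<noteq> 0 \<and> \<not> g dvd 1"
  for g :: "'k::field poly"
  by (auto simp: irreducible_def)

lemma irreducible_poly_degree_pos: "irreducible g \<Longrightarrow> 0 < degree g"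
  for g :: "'k::field poly"
  using irreducible_poly_not_unit[of g] is_unit_iff_degree by blast

lemma poly_power_dvd_decompose:
  fixes g a :: "'k::field poly"
  assumes g: "irreducible g" and a: "a \<noteq> 0"
  shows "\<exists>k b. a = g ^ k * b \<and> \<not> g dvd b"
  using a
proof (induction "degree a" arbitrary: a rule: less_induct)
  case less
  show ?case
  proof (cases "g dvd a")
    case True
    then obtain b where b: "a = g * b" by (elim dvdE)
    then have "b \<noteq> 0" "degree b < degree a"
      using less.prems irreducible_poly_degree_pos[OF g] by (auto simp: degree_mult_eq)
    then obtain k c where "b = g ^ k * c" "\<not> g dvd c" using less.hyps by blast
    then show ?thesis using b by (intro exI[of _ "Suc k"] exI[of _ c]) (simp add: mult.assoc)
  next
    case False
    then show ?thesis by (intro exI[of _ 0] exI[of _ a]) simp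
  qed
qed

lemma power_dvd_power_times_iff:
  fixes g b :: "'k::field poly"
  assumes "g \<noteq> 0" "\<not> g dvd b"
  shows "g ^ n dvd g ^ k * b \<longleftrightarrow> n \<le> k"
proof
  assume dvd: "g ^ n dvd g ^ k * b"
  show "n \<le> k"
  proof (rule ccontr)
    assume "\<not> n \<le> k"
    then have "n = k + Suc (n - k - 1)" by arith
    then have "g ^ n = g ^ k * (g * g ^ (n - k - 1))" by (metis power_Suc power_add)
    then have "g ^ k * (g * g ^ (n - k - 1)) dvd g ^ k * b" using dvd by simp
    then have "g * g ^ (n - k - 1) dvd b" using assms(1) by simp
    then have "g dvd b" by (rule dvd_mult_left)
    then show False using assms(2) by blast
  qed
next
  assume "n \<le> k"
  then show "g ^ n dvd g ^ k * b" by (intro dvd_mult2 le_imp_power_dvd)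
qed

lemma poly_val_eqI:
  fixes g b :: "'k::field poly"
  assumes "g \<noteq> 0" "\<not> g dvd b" "a = g ^ k * b"
  shows "poly_val g a = k"
proof -
  have "{n. g ^ n dvd a} = {..k}" using power_dvd_power_times_iff[OF assms(1,2)] assms(3) by auto
  then show ?thesis unfolding poly_val_def by (auto intro!: Max_eqI)
qed

lemma le_poly_val_iff:
  fixes g a :: "'k::field poly"
  assumes "irreducible g" "a \<noteq> 0"
  shows "n \<le> poly_val g a \<longleftrightarrow> g ^ n dvd a"
  using poly_power_dvd_decompose[OF assms] power_dvd_power_times_iff[of g] poly_val_eqI[of g]
    irreducible_poly_not_unit[OF assms(1)] by metis

lemma poly_val_mult:
  fixes g a b :: "'k::field poly"
  assumes g: "irreducible g" and "a \<noteq> 0" "b \<noteq> 0"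
  shows "poly_val g (a * b) = poly_val g a + poly_val g b"
proof -
  have g0: "g \<noteq> 0" using irreducible_poly_not_unit[OF g] by blast
  obtain k c where c: "a = g ^ k * c" "\<not> g dvd c"
    using poly_power_dvd_decompose[OF g \<open>a \<noteq> 0\<close>] by blast
  obtain l d where d: "b = g ^ l * d" "\<not> g dvd d"
    using poly_power_dvd_decompose[OF g \<open>b \<noteq> 0\<close>] by blast
  have "\<not> g dvd c * d"
    using c(2) d(2) prime_elem_dvd_mult_iff[OF field_poly_irreducible_imp_prime[OF g]] by blast
  moreover have "a * b = g ^ (k + l) * (c * d)" using c d by (simp add: power_add algebra_simps)
  ultimately show ?thesis
    using poly_val_eqI[OF g0] c d by metis
qed

lemma poly_val_not_dvd: "g \<noteq> 0 \<Longrightarrow> \<not> g dvd a \<Longrightarrow> poly_val g a = 0" for g :: "'k::field poly"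
  by (rule poly_val_eqI) auto

lemma poly_val_self: "irreducible g \<Longrightarrow> poly_val g g = 1" for g :: "'k::field poly"
  using poly_val_eqI[of g 1 g 1] irreducible_poly_not_unit[of g] by simp

lemma poly_val_const: "irreducible g \<Longrightarrow> c \<noteq> 0 \<Longrightarrow> poly_val g [:c:] = 0"
  for g :: "'k::field poly"
  using irreducible_poly_degree_pos[of g] dvd_imp_degree_le[of g "[:c:]"]
  by (intro poly_val_not_dvd) auto

text \<open>Two fractions for the same element agree after cross-multiplication, and
  multiplicativity of \<open>poly_val\<close> turns this into equality of the differences.\<close>

lemma fract_val_Fract:
  fixes g a b :: "'k::field poly"
  assumes g: "irreducible g" and "a \<noteq> 0" "b \<noteq> 0"
  shows "fract_val g (Fract a b) = int (poly_val g a) - int (poly_val g b)"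
  unfolding fract_val_def
proof (rule the_equality)
  fix k
  assume "\<exists>c d. c \<noteq> 0 \<and> d \<noteq> 0 \<and> Fract a b = Fract c d \<and> k = int (poly_val g c) - int (poly_val g d)"
  then obtain c d where cd: "c \<noteq> 0" "d \<noteq> 0" "a * d = c * b" 
    "k = int (poly_val g c) - int (poly_val g d)"
    using assms by (auto simp: eq_fract)
  then have "poly_val g a + poly_val g d = poly_val g c + poly_val g b"
    using poly_val_mult[OF g] assms by metis
  then show "k = int (poly_val g a) - int (poly_val g b)" using cd(4) by linarith
qed (use assms in blast)

lemma fract_val_to_fract:
  assumes "irreducible g" "a \<noteq> 0"
  shows "fract_val g (to_fract a) = int (poly_val g a)"
  using fract_val_Fract[OF assms one_neq_zero] poly_val_not_dvd[of g 1]
    irreducible_poly_not_unit[OF assms(1)] by (simp add: Fract_conv_to_fract)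

lemma fract_val_mult:
  assumes g: "irreducible g" and "x \<noteq> 0" "y \<noteq> 0"
  shows "fract_val g (x * y) = fract_val g x + fract_val g y"
proof -
  obtain a b where x: "x = Fract a b" "b \<noteq> 0" "a \<noteq> 0" using assms(2) by (cases x rule: Fract_cases_nonzero) auto
  obtain c d where y: "y = Fract c d" "d \<noteq> 0" "c \<noteq> 0" using assms(3) by (cases y rule: Fract_cases_nonzero) auto
  show ?thesis using x y by (simp add: fract_val_Fract[OF g] poly_val_mult[OF g])
qed

lemma fract_val_associated:
  assumes "g dvd h" "h dvd g"
  shows "fract_val g = fract_val h"
proof -
  have "g ^ n dvd a \<longleftrightarrow> h ^ n dvd a" for n a
    using assms by (meson dvd_power_same dvd_trans)
  then have "poly_val g = poly_val h" unfolding poly_val_def by presburger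
  then show ?thesis unfolding fract_val_def by presburger
qed

lemma exists_irreducible_factor:
  fixes u :: "'k::field poly"
  assumes "0 < degree u"
  shows "\<exists>a. irreducible a \<and> a dvd u"
  using assms
proof (induction "degree u" arbitrary: u rule: less_induct)
  case less
  have "u \<noteq> 0" using less.prems by auto
  then have u0: "u \<noteq> 0" "\<not> u dvd 1" using less.prems is_unit_iff_degree[of u] by simp_all
  show ?case
  proof (cases "irreducible u")
    case False
    then obtain a b where ab: "u = a * b" "\<not> a dvd 1" "\<not> b dvd 1"
      using u0 irreducibleI[of u] by metis
    then have "a \<noteq> 0" "b \<noteq> 0" using u0 by auto
    then have "0 < degree a" "0 < degree b" using ab is_unit_iff_degree by blast+
    then have "degree a < degree u" using ab \<open>a \<noteq> 0\<close> \<open>b \<noteq> 0\<close> by (simp add: degree_mult_eq)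
    then obtain c where "irreducible c" "c dvd a" using less.hyps \<open>0 < degree a\<close> by blast
    then show ?thesis using ab(1) dvd_mult2 by blast
  qed (use dvd_refl in blast)
qed

lemma irreducible_poly_dvd_imp_associated:
  fixes g h :: "'k::field poly"
  assumes "irreducible g" "irreducible h" "g dvd h"
  shows "h dvd g"
  using assms irreducibleD' irreducible_poly_not_unit by blast

lemma irreducible_of_associated:
  fixes a b :: "'a::comm_semiring_1"
  assumes a: "irreducible a" and "a dvd b" "b dvd a"
  shows "irreducible b"
proof (rule irreducibleI)
  show "b \<noteq> 0" using a assms(3) by auto
  show "\<not> b dvd 1" using irreducible_not_unit[OF a] dvd_trans[OF assms(2)] by blast
  fix x y assume "b = x * y"
  moreover obtain e where "a = b * e" using assms(3) by (elim dvdE)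
  ultimately have "a = x * (y * e)" by (simp add: mult.assoc)
  then have "x dvd 1 \<or> y * e dvd 1" using irreducibleD[OF a] by blast
  then show "x dvd 1 \<or> y dvd 1" using dvd_mult_left by blast
qed

section \<open>Valuations and primitive polynomials over a factorial domain\<close>

lemma prime_elem_imp_infinite_UNIV:
  fixes p :: "'a::factorial_semiring"
  assumes "prime_elem p"
  shows "infinite (UNIV :: 'a set)"
proof -
  have "inj (\<lambda>n. p ^ n)"
    by (rule inj_on_inverseI[of _ "multiplicity p"]) (simp add: multiplicity_prime_power[OF assms])
  then show ?thesis using range_inj_infinite infinite_super subset_UNIV by metis
qed

lemma fin_prime_prod_eq:
  assumes "finite S" "S \<subseteq> \<Q>" "\<And>p. p \<in> \<Q> \<Longrightarrow> k p \<noteq> 0 \<Longrightarrow> p \<in> S"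
  shows "fin_prime_prod \<Q> k = (\<Prod>p\<in>S. p ^ k p)"
  unfolding fin_prime_prod_def using assms by (intro prod.mono_neutral_left) (auto intro!: gr0I)

lemma prime_representatives_dvd_imp_eq:
  assumes "prime_representatives \<Q>" "p \<in> \<Q>" "q \<in> \<Q>" "p dvd q"
  shows "p = (q :: 'a::{factorial_semiring,idom})"
proof -
  have pq: "prime_elem p" "prime_elem q" using assms unfolding prime_representatives_def by auto
  then have "q dvd p"
    using assms(4) irreducibleD'[OF prime_elem_imp_irreducible[OF pq(2)]] by (auto simp: prime_elem_def)
  moreover have "\<exists>!r. r \<in> \<Q> \<and> r dvd q \<and> q dvd r"
    using assms(1) pq(2) unfolding prime_representatives_def by blast
  ultimately show ?thesis using assms(2-4) dvd_refl by blast
qed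

text \<open>Distinct representatives are not associated, so only the factor of \<open>p\<close>
  itself contributes. Finiteness matters because a product over an infinite support is 1.\<close>

lemma multiplicity_fin_prime_prod:
  fixes \<Q> :: "'a::{factorial_semiring,idom} set"
  assumes \<Q>: "prime_representatives \<Q>" and fin: "finite {q \<in> \<Q>. k q \<noteq> 0}" and p: "p \<in> \<Q>"
  shows "multiplicity p (fin_prime_prod \<Q> k) = k p"
proof -
  define S where "S = insert p {q \<in> \<Q>. k q \<noteq> 0}"
  have S: "finite S" "S \<subseteq> \<Q>" "p \<in> S" unfolding S_def using fin p by auto
  have pe: "prime_elem q" if "q \<in> \<Q>" for q using \<Q> that unfolding prime_representatives_def by blast
  have nz: "q ^ k q \<noteq> 0" if "q \<in> S" for q using pe[of q] that S(2) by auto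
  have mult: "multiplicity p (q ^ k q) = (if q = p then k p else 0)" if q: "q \<in> S" for q
  proof (cases "q = p")
    case False
    then have "\<not> p dvd q" using prime_representatives_dvd_imp_eq[OF \<Q> p] q S(2) by blast
    then have "multiplicity p q = 0" by (rule not_dvd_imp_multiplicity_0)
    moreover have "q \<noteq> 0" using pe[of q] q S(2) by auto
    ultimately show ?thesis using False prime_elem_multiplicity_power_distrib[OF pe[OF p]] by simp
  qed (simp add: pe[OF p])
  have "multiplicity p (fin_prime_prod \<Q> k) = multiplicity p (\<Prod>q\<in>S. q ^ k q)"
    using fin_prime_prod_eq[OF S(1,2), of k] by (simp add: S_def)
  also have "\<dots> = (\<Sum>q\<in>S. multiplicity p (q ^ k q))"
    using nz S(1) by (intro prime_elem_multiplicity_prod_distrib[OF pe[OF p]]) force+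
  also have "\<dots> = (\<Sum>q\<in>S. if q = p then k p else 0)" by (rule sum.cong) (auto simp: mult)
  also have "\<dots> = k p" using S by simp
  finally show ?thesis .
qed

section \<open>Prime valuations on the quotient field\<close>

locale quotient_field =
  fixes \<iota> :: "'a::{factorial_semiring,idom} \<Rightarrow> 'k::field"
  assumes embedding: "quotient_field_embedding \<iota>"
begin

lemma hom_one: "\<iota> 1 = 1"
  and hom_add: "\<iota> (x + y) = \<iota> x + \<iota> y"
  and hom_mult: "\<iota> (x * y) = \<iota> x * \<iota> y"
  and inj_hom: "inj \<iota>"
  using embedding unfolding quotient_field_embedding_def by auto

lemma exists_fraction: "\<exists>a b. b \<noteq> 0 \<and> z = \<iota> a / \<iota> b"
  using embedding unfolding quotient_field_embedding_def by auto

lemma hom_zero: "\<iota> 0 = 0"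
  using hom_add[of 0 0] by (metis add.right_neutral add_left_cancel)

lemma hom_eq_iff: "\<iota> x = \<iota> y \<longleftrightarrow> x = y"
  using inj_hom by (auto dest: injD)

lemma hom_eq_zero_iff: "\<iota> x = 0 \<longleftrightarrow> x = 0"
  using hom_eq_iff[of x 0] hom_zero by simp

lemma hom_minus: "\<iota> (x - y) = \<iota> x - \<iota> y"
  using hom_add[of "x - y" y] by simp

lemma hom_power: "\<iota> (x ^ n) = \<iota> x ^ n"
  by (induction n) (simp_all add: hom_one hom_mult)

lemma hom_sum: "\<iota> (sum g A) = (\<Sum>i\<in>A. \<iota> (g i))"
  by (induction A rule: infinite_finite_induct) (simp_all add: hom_zero hom_add)

lemma exists_nonzero_fraction: "z \<noteq> 0 \<Longrightarrow> \<exists>a b. a \<noteq> 0 \<and> b \<noteq> 0 \<and> z = \<iota> a / \<iota> b"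
  using exists_fraction[of z] hom_zero by (metis div_0)

text \<open>The \<open>p\<close>-adic valuation of \<open>K\<close>. No admissible fraction has
  numerator 0, so the value at 0 is unspecified.\<close>

definition val :: "'a \<Rightarrow> 'k \<Rightarrow> int" where
  "val p z = (THE k. \<exists>a b. a \<noteq> 0 \<and> b \<noteq> 0 \<and> z = \<iota> a / \<iota> b \<and>
     k = int (multiplicity p a) - int (multiplicity p b))"

lemma val_fraction:
  assumes p: "prime_elem p" and "a \<noteq> 0" "b \<noteq> 0"
  shows "val p (\<iota> a / \<iota> b) = int (multiplicity p a) - int (multiplicity p b)"
  unfolding val_def
proof (rule the_equality)
  fix k
  assume "\<exists>c d. c \<noteq> 0 \<and> d \<noteq> 0 \<and> \<iota> a / \<iota> b = \<iota> c / \<iota> d \<and>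
    k = int (multiplicity p c) - int (multiplicity p d)"
  then obtain c d where cd: "c \<noteq> 0" "d \<noteq> 0" "\<iota> a / \<iota> b = \<iota> c / \<iota> d" 
    "k = int (multiplicity p c) - int (multiplicity p d)"
    by blast
  then have "\<iota> (a * d) = \<iota> (c * b)" using assms by (simp add: hom_eq_zero_iff hom_mult frac_eq_eq)
  then have "a * d = c * b" using hom_eq_iff by blast
  then have "multiplicity p a + multiplicity p d = multiplicity p c + multiplicity p b"
    using prime_elem_multiplicity_mult_distrib[OF p] assms cd by metis
  then show "k = int (multiplicity p a) - int (multiplicity p b)" using cd(4) by linarith
qed (use assms in blast)

lemma val_hom: "prime_elem p \<Longrightarrow> a \<noteq> 0 \<Longrightarrow> val p (\<iota> a) = int (multiplicity p a)"
  using val_fraction[of p a 1] hom_one by simp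

lemma val_mult:
  assumes p: "prime_elem p" and "x \<noteq> 0" "y \<noteq> 0"
  shows "val p (x * y) = val p x + val p y"
proof -
  obtain a b c d where abcd: "a \<noteq> 0" "b \<noteq> 0" "x = \<iota> a / \<iota> b" "c \<noteq> 0" "d \<noteq> 0" "y = \<iota> c / \<iota> d"
    using exists_nonzero_fraction assms by metis
  then have "x * y = \<iota> (a * c) / \<iota> (b * d)" by (simp add: hom_mult)
  with abcd show ?thesis
    by (simp add: val_fraction[OF p] prime_elem_multiplicity_mult_distrib[OF p])
qed

lemma val_power: "prime_elem p \<Longrightarrow> x \<noteq> 0 \<Longrightarrow> val p (x ^ n) = int n * val p x"
  by (induction n) (use val_hom[of p 1] hom_one in \<open>auto simp: val_mult algebra_simps\<close>)

lemma val_nonneg: "prime_elem p \<Longrightarrow> z \<noteq> 0 \<Longrightarrow> z \<in> range \<iota> \<Longrightarrow> 0 \<le> val p z"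
  by (elim rangeE) (metis hom_eq_zero_iff of_nat_0_le_iff val_hom)

text \<open>A fraction lies in the ring once its denominator divides its numerator, and in a
  factorial domain divisibility is decided by the multiplicities of normalized primes.\<close>

lemma in_range_iff_val_nonneg:
  assumes "z \<noteq> 0"
  shows "z \<in> range \<iota> \<longleftrightarrow> (\<forall>p. prime p \<longrightarrow> 0 \<le> val p z)"
proof
  assume "z \<in> range \<iota>"
  then show "\<forall>p. prime p \<longrightarrow> 0 \<le> val p z" using val_nonneg assms prime_imp_prime_elem by blast
next
  assume *: "\<forall>p. prime p \<longrightarrow> 0 \<le> val p z"
  obtain a b where ab: "a \<noteq> 0" "b \<noteq> 0" "z = \<iota> a / \<iota> b" using exists_nonzero_fraction[OF assms] by blast
  have "b dvd a"
  proof (rule multiplicity_le_imp_dvd[OF ab(2)])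
    fix p :: 'a assume "prime p"
    then show "multiplicity p b \<le> multiplicity p a"
      using *[rule_format, of p] ab val_fraction[of p a b] prime_imp_prime_elem by auto
  qed
  then obtain c where "a = b * c" by (elim dvdE)
  then have "z = \<iota> c" using ab by (simp add: hom_mult hom_eq_zero_iff)
  then show "z \<in> range \<iota>" by blast
qed

text \<open>Without prime elements every nonzero fraction passes the test for lying in the ring.
  This settles finite rings, where \<open>f\<close> may vanish at all points.\<close>

lemma infinite_or_surj: "infinite (UNIV :: 'a set) \<or> surj \<iota>"
proof (cases "\<exists>p::'a. prime_elem p")
  case True
  then show ?thesis using prime_elem_imp_infinite_UNIV by blast
next
  case False
  have "z \<in> range \<iota>" for z
  proof (cases "z = 0")
    case True
    then show ?thesis using hom_zero by (metis rangeI)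
  next
    case z: False
    show ?thesis using in_range_iff_val_nonneg[OF z] False prime_imp_prime_elem by blast
  qed
  then show ?thesis by blast
qed

section \<open>Polynomials over the ring, primitivity and Gauss's lemma\<close>

lemma map_poly_mult: "map_poly \<iota> (u * v) = map_poly \<iota> u * map_poly \<iota> v"
  by (rule poly_eqI) (simp add: coeff_map_poly hom_zero coeff_mult hom_sum hom_mult)

lemma map_poly_eq_iff: "map_poly \<iota> u = map_poly \<iota> v \<longleftrightarrow> u = v"
  by (auto simp: poly_eq_iff coeff_map_poly hom_zero hom_eq_iff)

lemma map_poly_smult_hom: "map_poly \<iota> (smult c u) = smult (\<iota> c) (map_poly \<iota> u)"
  by (rule poly_eqI) (simp add: coeff_map_poly hom_zero hom_mult)

lemma poly_map_poly: "poly (map_poly \<iota> u) (\<iota> x) = \<iota> (poly u x)"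
  by (induction u) (simp_all add: map_poly_pCons hom_zero hom_add hom_mult)

lemma map_poly_in_Int: "map_poly \<iota> u \<in> Int_poly \<iota>"
  unfolding Int_poly_def using poly_map_poly by auto

lemma coeffs_in_range_imp:
  assumes "\<forall>n. coeff u n \<in> range \<iota>"
  shows "\<exists>v. u = map_poly \<iota> v"
proof
  show "u = map_poly \<iota> (map_poly (inv \<iota>) u)"
    using assms inv_f_f[OF inj_hom, of 0] 
    by (intro poly_eqI) (simp add: coeff_map_poly hom_zero f_inv_into_f)
qed

lemma exists_common_denominator: "\<exists>d v. d \<noteq> 0 \<and> smult (\<iota> d) u = map_poly \<iota> v"
proof (induction u)
  case 0
  show ?case by (intro exI[of _ 1] exI[of _ 0]) simp
next
  case (pCons c u)
  then obtain d v where dv: "d \<noteq> 0" "smult (\<iota> d) u = map_poly \<iota> v" by blast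
  obtain a b where ab: "b \<noteq> 0" "c = \<iota> a / \<iota> b" using exists_fraction by blast
  have "smult (\<iota> (d * b)) (pCons c u) = map_poly \<iota> (pCons (d * a) (smult b v))"
    using dv(2)[symmetric] ab
    by (simp add: map_poly_pCons hom_zero hom_mult hom_eq_zero_iff map_poly_smult_hom mult.commute)
  with dv ab show ?case by (metis mult_eq_0_iff)
qed

definition primitive :: "'a poly \<Rightarrow> bool" where
  "primitive v \<longleftrightarrow> (\<forall>p. prime_elem p \<longrightarrow> \<not> [:p:] dvd v)"

lemma size_prime_factorization_mult_prime:
  fixes p x :: 'a
  assumes "prime_elem p" "x \<noteq> 0"
  shows "size (prime_factorization x) < size (prime_factorization (p * x))"
proof -
  have "prime_factorization p \<noteq> {#}" 
    using assms(1) by (auto simp: prime_factorization_empty_iff prime_elem_def)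
  then have "0 < size (prime_factorization p)" by (meson gr0I size_eq_0_iff_empty)
  moreover have "p \<noteq> 0" using assms(1) by auto
  ultimately show ?thesis using assms by (simp add: prime_factorization_mult)
qed

text \<open>Each prime constant split off removes a prime factor from the leading coefficient, so
  the process stops.\<close>

lemma exists_primitive_part:
  assumes "v \<noteq> 0"
  shows "\<exists>c u. c \<noteq> 0 \<and> v = smult c u \<and> primitive u"
  using assms
proof (induction "size (prime_factorization (lead_coeff v))" arbitrary: v rule: less_induct)
  case less
  show ?case
  proof (cases "primitive v")
    case True
    then show ?thesis by (intro exI[of _ 1] exI[of _ v]) simp
  next
    case False
    then obtain p u where p: "prime_elem p" "v = smult p u"
      unfolding primitive_def by (auto elim!: dvdE)
    then have u0: "u \<noteq> 0" "p \<noteq> 0" using less.prems by auto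
    have "lead_coeff v = p * lead_coeff u" using p by simp
    then have "size (prime_factorization (lead_coeff u)) < size (prime_factorization (lead_coeff v))"
      using size_prime_factorization_mult_prime[OF p(1), of "lead_coeff u"] u0 by simp
    then obtain c w where cw: "c \<noteq> 0" "u = smult c w" "primitive w" using less.hyps u0(1) by blast
    then have "v = smult (p * c) w" "p * c \<noteq> 0" using p u0(2) by auto
    with cw show ?thesis by blast
  qed
qed

text \<open>A prime factor \<open>p\<close> of \<open>d\<close> divides \<open>v * w\<close>. It
  stays prime as a constant polynomial and does not divide the primitive \<open>v\<close>, so it
  divides \<open>w\<close> and cancels; \<open>d\<close> loses a prime factor.\<close>

lemma primitive_dvd_of_smult:
  assumes "primitive v" "d \<noteq> 0" "smult d u = v * w"
  shows "v dvd u"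
  using assms(2,3)
proof (induction "size (prime_factorization d)" arbitrary: d w rule: less_induct)
  case less
  show ?case
  proof (cases "d dvd 1")
    case True
    then obtain e where "e * d = 1" by (metis dvdE mult.commute)
    then have "u = smult e (smult d u)" by simp
    also have "\<dots> = v * smult e w" using less.prems by simp
    finally show ?thesis by (rule dvdI)
  next
    case False
    then obtain p where p: "prime p" "p dvd d" using prime_divisorE less.prems(1) by blast
    then have pe: "prime_elem p" "p \<noteq> 0" by auto
    obtain d' where d': "d = p * d'" using p(2) by (elim dvdE)
    have "[:p:] * smult d' u = smult d u" using d' by (simp add: mult.commute)
    then have "[:p:] dvd v * w" using less.prems(2) by (metis dvdI)
    then have "[:p:] dvd w"
      using assms(1) pe prime_elem_dvd_mult_iff[OF lift_prime_elem_poly[OF pe(1)]]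
      unfolding primitive_def by blast
    then obtain w' where w': "w = smult p w'" by (auto elim!: dvdE)
    have "smult p (smult d' u) = smult p (v * w')" using less.prems(2) d' w' by simp
    then have "smult d' u = v * w'" using pe(2) by (metis smult_cancel)
    moreover have "d' \<noteq> 0" using less.prems(1) d' by auto
    ultimately show ?thesis
      using less.hyps size_prime_factorization_mult_prime[OF pe(1)] d' by blast
  qed
qed

text \<open>Clearing denominators in the cofactor gives \<open>smult d u = v * w\<close> over the
  ring, and primitivity of \<open>v\<close> removes \<open>d\<close>.\<close>

lemma gauss:
  assumes v: "primitive v" and dvd: "map_poly \<iota> v dvd map_poly \<iota> u"
  shows "v dvd u"
proof -
  obtain h where h: "map_poly \<iota> u = map_poly \<iota> v * h" using dvd by (elim dvdE)
  obtain d w where dw: "d \<noteq> 0" "smult (\<iota> d) h = map_poly \<iota> w" using exists_common_denominator by blast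
  have "map_poly \<iota> (smult d u) = map_poly \<iota> (v * w)"
    by (simp add: map_poly_smult_hom map_poly_mult h flip: dw(2))
  then show ?thesis using primitive_dvd_of_smult[OF v dw(1)] map_poly_eq_iff by blast
qed

lemma exists_primitive_associate:
  assumes "u \<noteq> 0"
  shows "\<exists>v. primitive v \<and> u dvd map_poly \<iota> v \<and> map_poly \<iota> v dvd u"
proof -
  obtain d w where dw: "d \<noteq> 0" "smult (\<iota> d) u = map_poly \<iota> w" using exists_common_denominator by blast
  have "w \<noteq> 0" using dw assms by (metis hom_eq_zero_iff map_poly_0 smult_eq_0_iff)
  then obtain c v where cv: "c \<noteq> 0" "w = smult c v" "primitive v" using exists_primitive_part by blast
  then have eq: "smult (\<iota> d) u = smult (\<iota> c) (map_poly \<iota> v)" using dw by (simp add: map_poly_smult_hom)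
  have "\<iota> c \<noteq> 0" "\<iota> d \<noteq> 0" using cv dw hom_eq_zero_iff by auto
  then show ?thesis using eq cv(3) by (metis dvd_refl dvd_smult_iff smult_dvd_iff)
qed

end

section \<open>The monoid of divisors of powers of a polynomial\<close>

text \<open>Irreducible factors of \<open>f\<close> in \<open>K[X]\<close> up to associates.
  Primitive representatives are required so that Gauss's lemma makes them divisors over the
  ring.\<close>

definition (in quotient_field) factor_representatives :: "'k poly \<Rightarrow> 'k poly set \<Rightarrow> bool" where
  "factor_representatives f G \<longleftrightarrow> finite G \<and>
    (\<forall>g\<in>G. irreducible g \<and> g dvd f \<and> (\<exists>v. primitive v \<and> g = map_poly \<iota> v)) \<and>
    (\<forall>g\<in>G. \<forall>h\<in>G. g dvd h \<longrightarrow> g = h) \<and>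
    (\<forall>a. irreducible a \<longrightarrow> a dvd f \<longrightarrow> (\<exists>g\<in>G. g dvd a \<and> a dvd g))"

text \<open>Induction on the degree: an irreducible factor \<open>a\<close> is split off, and the
  representatives of the cofactor are extended by a primitive associate of \<open>a\<close> unless
  \<open>a\<close> is represented already.\<close>

lemma (in quotient_field) exists_factor_representatives:
  assumes "f \<noteq> 0"
  shows "\<exists>G. factor_representatives f G"
  using assms
proof (induction "degree f" arbitrary: f rule: less_induct)
  case less
  show ?case
  proof (cases "degree f = 0")
    case True
    then have unit: "f dvd 1" using less.prems is_unit_iff_degree by blast
    have "\<not> a dvd f" if "irreducible a" for a
      using irreducible_poly_not_unit[OF that] dvd_trans[OF _ unit] by blast
    then show ?thesis unfolding factor_representatives_def by (intro exI[of _ "{}"]) simp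
  next
    case False
    then obtain a f' where a: "irreducible a" "f = a * f'"
      using exists_irreducible_factor[of f] by (auto elim!: dvdE)
    have "f' \<noteq> 0" "a \<noteq> 0" using a less.prems by auto
    then have "degree f' < degree f" 
      using a irreducible_poly_degree_pos[OF a(1)] by (simp add: degree_mult_eq)
    from less.hyps[OF this \<open>f' \<noteq> 0\<close>] obtain G where "factor_representatives f' G" by blast
    then have G: "finite G"
      "\<And>g. g \<in> G \<Longrightarrow> irreducible g" "\<And>g. g \<in> G \<Longrightarrow> g dvd f'"
      "\<And>g. g \<in> G \<Longrightarrow> \<exists>v. primitive v \<and> g = map_poly \<iota> v"
      "\<And>g h. g \<in> G \<Longrightarrow> h \<in> G \<Longrightarrow> g dvd h \<Longrightarrow> g = h"
      "\<And>a. irreducible a \<Longrightarrow> a dvd f' \<Longrightarrow> \<exists>g\<in>G. g dvd a \<and> a dvd g"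
      unfolding factor_representatives_def by simp_all
    obtain v where v: "primitive v" "a dvd map_poly \<iota> v" "map_poly \<iota> v dvd a"
      using exists_primitive_associate[OF \<open>a \<noteq> 0\<close>] by blast
    define b where "b = map_poly \<iota> v"
    have ab: "a dvd b" "b dvd a" using v b_def by auto
    have irr_b: "irreducible b" using irreducible_of_associated[OF a(1) ab] .
    define G' where "G' = (if \<exists>g\<in>G. g dvd a \<and> a dvd g then G else insert b G)"
    have sub: "G' \<subseteq> insert b G" "G \<subseteq> G'" unfolding G'_def by auto
    have rep_a: "\<exists>g\<in>G'. g dvd a \<and> a dvd g" unfolding G'_def using ab by auto
    have f'f: "f' dvd f" "a dvd f" using a by auto
    have "finite G'" unfolding G'_def using G(1) by simp
    moreover have "\<forall>g\<in>G'. irreducible g \<and> g dvd f \<and> (\<exists>v. primitive v \<and> g = map_poly \<iota> v)"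
    proof
      fix g assume "g \<in> G'"
      then consider "g = b" | "g \<in> G" using sub by blast
      then show "irreducible g \<and> g dvd f \<and> (\<exists>v. primitive v \<and> g = map_poly \<iota> v)"
      proof cases
        case 1
        then show ?thesis using irr_b dvd_trans[OF ab(2) f'f(2)] v(1) b_def by blast
      next
        case 2
        then show ?thesis using G(2-4) dvd_trans[OF _ f'f(1)] by blast
      qed
    qed
    moreover have "\<forall>g\<in>G'. \<forall>h\<in>G'. g dvd h \<longrightarrow> g = h"
    proof (cases "\<exists>g\<in>G. g dvd a \<and> a dvd g")
      case True
      then show ?thesis using G(5) unfolding G'_def by simp
    next
      case False
      have "\<not> g dvd b \<and> \<not> b dvd g" if g: "g \<in> G" for g
      proof -
        have "g dvd b \<longleftrightarrow> b dvd g"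
          using irreducible_poly_dvd_imp_associated G(2)[OF g] irr_b by blast
        then show ?thesis using False g ab dvd_trans by blast
      qed
      then show ?thesis using G(5) unfolding G'_def by auto
    qed
    moreover have "\<exists>g\<in>G'. g dvd c \<and> c dvd g" if c: "irreducible c" "c dvd f" for c
    proof -
      have "c dvd a \<or> c dvd f'"
        using c a(2) prime_elem_dvd_mult_iff[OF field_poly_irreducible_imp_prime[OF c(1)]] by blast
      then show ?thesis
      proof
        assume "c dvd a"
        then have "a dvd c" using irreducible_poly_dvd_imp_associated c(1) a(1) by blast
        then show ?thesis using rep_a \<open>c dvd a\<close> dvd_trans by blast
      next
        assume "c dvd f'"
        then show ?thesis using G(6) c(1) sub(2) by blast
      qed
    qed
    ultimately show ?thesis unfolding factor_representatives_def by blast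
  qed
qed

section \<open>Divisors of powers of f in K[X] and their values\<close>

locale integer_valued_divisors = quotient_field \<iota>
  for \<iota> :: "'a::{factorial_semiring,idom} \<Rightarrow> 'k::field" +
  fixes f :: "'k poly"
  assumes f_nonzero: "f \<noteq> 0" and f_coeffs: "\<forall>n. coeff f n \<in> range \<iota>"
begin

definition G :: "'k poly set" where
  "G = (SOME G. factor_representatives f G)"

lemma finite_G: "finite G"
  and G_irreducible: "g \<in> G \<Longrightarrow> irreducible g"
  and G_dvd: "g \<in> G \<Longrightarrow> g dvd f"
  and G_primitive: "g \<in> G \<Longrightarrow> \<exists>v. primitive v \<and> g = map_poly \<iota> v"
  and G_dvd_imp_eq: "g \<in> G \<Longrightarrow> h \<in> G \<Longrightarrow> g dvd h \<Longrightarrow> g = h"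
  and G_represents: "irreducible a \<Longrightarrow> a dvd f \<Longrightarrow> \<exists>g\<in>G. g dvd a \<and> a dvd g"
  using someI_ex[OF exists_factor_representatives[OF f_nonzero], folded G_def]
  unfolding factor_representatives_def by simp_all

abbreviation D where "D \<equiv> div_closed \<iota> f"
abbreviation H where "H \<equiv> div_monoid \<iota> f"
abbreviation ev where "ev u c \<equiv> poly u (\<iota> c)"

text \<open>The analogue of \<open>[[f]]\<close> over the field: integrality is dropped, so all
  nonzero constants belong to it. Its elements vanish at most where \<open>f\<close> does, so
  \<open>val\<close> can be applied to their values at nonroots.\<close>

definition M :: "'k poly set" where
  "M = {u. \<exists>k. u dvd f ^ k}"

definition nonroots :: "'a set" where
  "nonroots = {c. ev f c \<noteq> 0}"

lemma M_nonzero: "u \<in> M \<Longrightarrow> u \<noteq> 0"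
  unfolding M_def using f_nonzero by auto

lemma M_mult: "u \<in> M \<Longrightarrow> v \<in> M \<Longrightarrow> u * v \<in> M"
proof -
  assume "u \<in> M" "v \<in> M"
  then obtain k l where "u dvd f ^ k" "v dvd f ^ l" unfolding M_def by blast
  then have "u * v dvd f ^ (k + l)" unfolding power_add by (rule mult_dvd_mono)
  then show ?thesis unfolding M_def by blast
qed

lemma M_dvd: "v \<in> M \<Longrightarrow> u dvd v \<Longrightarrow> u \<in> M"
  unfolding M_def using dvd_trans by blast

lemma M_const: "r \<noteq> 0 \<Longrightarrow> [:r:] \<in> M"
  unfolding M_def by (intro CollectI exI[of _ 0]) (simp add: is_unit_const_poly_iff dvd_field_iff)

lemma f_in_M: "f \<in> M"
  unfolding M_def by (intro CollectI exI[of _ 1]) simp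

lemma G_subset_M: "g \<in> G \<Longrightarrow> g \<in> M"
  using G_dvd f_in_M M_dvd by blast

lemma ev_M_nonzero: "u \<in> M \<Longrightarrow> c \<in> nonroots \<Longrightarrow> ev u c \<noteq> 0"
proof -
  assume "u \<in> M" "c \<in> nonroots"
  then obtain k h where "f ^ k = u * h" "ev f c \<noteq> 0" unfolding M_def nonroots_def by (auto elim!: dvdE)
  then have "ev u c * ev h c = ev f c ^ k" "ev f c \<noteq> 0" by (metis poly_mult poly_power)+
  then show ?thesis by auto
qed

text \<open>An irreducible factor of a divisor of \<open>f ^ k\<close> divides \<open>f\<close>, so
  it is associated to an element of \<open>G\<close>. Elements of \<open>M\<close> are thus products
  of elements of \<open>G\<close> with one nonzero constant.\<close>

lemma M_induct [consumes 1, case_names const mult]: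
  assumes "u \<in> M" and "\<And>r. r \<noteq> 0 \<Longrightarrow> P [:r:]"
    and "\<And>g v. g \<in> G \<Longrightarrow> v \<in> M \<Longrightarrow> P v \<Longrightarrow> P (g * v)"
  shows "P u"
  using assms(1)
proof (induction "degree u" arbitrary: u rule: less_induct)
  case less
  show ?case
  proof (cases "degree u = 0")
    case True
    then obtain r where "u = [:r:]" by (elim degree_eq_zeroE)
    then show ?thesis using assms(2) M_nonzero[OF less.prems] by auto
  next
    case False
    then obtain a where a: "irreducible a" "a dvd u" using exists_irreducible_factor by blast
    obtain k where "u dvd f ^ k" using less.prems unfolding M_def by blast
    then have "a dvd f"
      using a dvd_trans prime_elem_dvd_power[OF field_poly_irreducible_imp_prime[OF a(1)]] by blast
    then obtain g where g: "g \<in> G" "g dvd u" using G_represents a dvd_trans by blast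
    then obtain v where v: "u = g * v" by (elim dvdE)
    then have "v \<in> M" using M_dvd[OF less.prems] by simp
    moreover have "degree v < degree u"
      using v M_nonzero[OF less.prems] irreducible_poly_degree_pos[OF G_irreducible[OF g(1)]]
      by (auto simp: degree_mult_eq)
    ultimately show ?thesis using less.hyps assms(3) g(1) v by blast
  qed
qed

lemma M_dvd_of_poly_val_le:
  assumes "b \<in> M" "a \<noteq> 0" "\<And>g. g \<in> G \<Longrightarrow> poly_val g b \<le> poly_val g a"
  shows "b dvd a"
  using assms
proof (induction b arbitrary: a rule: M_induct)
  case (const r)
  then show ?case by (metis const_poly_dvd_iff dvd_field_iff)
next
  case (mult g v)
  have irr: "irreducible g" using mult.hyps G_irreducible by blast
  have v0: "v \<noteq> 0" "g \<noteq> 0" using mult.hyps M_nonzero G_subset_M by auto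
  have "1 \<le> poly_val g a"
    using mult.prems(2)[OF mult.hyps(1)] poly_val_mult[OF irr v0(2,1)] poly_val_self[OF irr] by simp
  then have "g dvd a" using le_poly_val_iff[OF irr mult.prems(1), of 1] by simp
  then obtain a' where a': "a = g * a'" by (elim dvdE)
  then have "a' \<noteq> 0" using mult.prems by auto
  moreover have "poly_val h v \<le> poly_val h a'" if "h \<in> G" for h
    using mult.prems(2)[OF that] a' \<open>a' \<noteq> 0\<close> v0 by (simp add: poly_val_mult G_irreducible that)
  ultimately have "v dvd a'" using mult.IH by blast
  then show ?case using a' by simp
qed

lemma ev_G: "g \<in> G \<Longrightarrow> ev g c \<in> range \<iota>"
  using G_primitive poly_map_poly by fastforce

text \<open>Constants have equal values at both points and values of products add, so a comparison
  of two points on the finite set \<open>G\<close> extends to all of \<open>M\<close>.\<close>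

lemma val_ev_mono:
  assumes p: "prime_elem p" and ct: "c \<in> nonroots" "t \<in> nonroots"
    and le: "\<And>g. g \<in> G \<Longrightarrow> val p (ev g t) \<le> val p (ev g c)" and u: "u \<in> M"
  shows "val p (ev u t) \<le> val p (ev u c)"
  using u
proof (induction u rule: M_induct)
  case (mult g v)
  then show ?case using le[OF mult.hyps(1)] ct
    by (simp add: val_mult[OF p] ev_M_nonzero G_subset_M)
qed simp

text \<open>Elements of \<open>G\<close> have coefficients in the ring, so their values have
  nonnegative valuations and Dickson's lemma applies to the vectors indexed by
  \<open>G\<close>.\<close>

lemma exists_minimal_points:
  assumes p: "prime_elem p"
  shows "\<exists>T\<subseteq>nonroots. finite T \<and> (\<forall>c\<in>nonroots. \<exists>t\<in>T. \<forall>u\<in>M. val p (ev u t) \<le> val p (ev u c))"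
proof -
  obtain T where T: "T \<subseteq> nonroots" "finite T"
    "\<forall>c\<in>nonroots. \<exists>t\<in>T. \<forall>g\<in>G. nat (val p (ev g t)) \<le> nat (val p (ev g c))"
    using dickson[OF finite_G, of nonroots "\<lambda>g c. nat (val p (ev g c))"] by blast
  have "\<exists>t\<in>T. \<forall>u\<in>M. val p (ev u t) \<le> val p (ev u c)" if c: "c \<in> nonroots" for c
  proof -
    obtain t where t: "t \<in> T" "\<And>g. g \<in> G \<Longrightarrow> nat (val p (ev g t)) \<le> nat (val p (ev g c))"
      using T(3) c by blast
    have tn: "t \<in> nonroots" using t(1) T(1) by blast
    have "val p (ev g t) \<le> val p (ev g c)" if g: "g \<in> G" for g
      using t(2)[OF g] val_nonneg[OF p ev_M_nonzero[OF G_subset_M[OF g] c] ev_G[OF g]] by linarith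
    then show ?thesis using val_ev_mono[OF p c tn] t(1) by blast
  qed
  then show ?thesis using T by blast
qed

definition T :: "'a \<Rightarrow> 'a set" where
  "T p = (SOME T. T \<subseteq> nonroots \<and> finite T \<and>
     (\<forall>c\<in>nonroots. \<exists>t\<in>T. \<forall>u\<in>M. val p (ev u t) \<le> val p (ev u c)))"

lemma T_properties:
  assumes "prime_elem p"
  shows "T p \<subseteq> nonroots \<and> finite (T p) \<and>
     (\<forall>c\<in>nonroots. \<exists>t\<in>T p. \<forall>u\<in>M. val p (ev u t) \<le> val p (ev u c))"
  unfolding T_def by (rule someI_ex) (rule exists_minimal_points[OF assms])

lemma T_subset: "prime_elem p \<Longrightarrow> t \<in> T p \<Longrightarrow> t \<in> nonroots"
  using T_properties by blast

lemma finite_T: "prime_elem p \<Longrightarrow> finite (T p)"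
  using T_properties by simp

lemma T_minimal:
  "prime_elem p \<Longrightarrow> c \<in> nonroots \<Longrightarrow> \<exists>t\<in>T p. \<forall>u\<in>M. val p (ev u t) \<le> val p (ev u c)"
  using T_properties by simp

section \<open>The monoid of integer-valued divisors\<close>

lemma range_mult: "z \<in> range \<iota> \<Longrightarrow> y \<in> range \<iota> \<Longrightarrow> z * y \<in> range \<iota>"
  by (elim rangeE) (simp flip: hom_mult)

lemma range_diff: "z \<in> range \<iota> \<Longrightarrow> y \<in> range \<iota> \<Longrightarrow> z - y \<in> range \<iota>"
  by (elim rangeE) (simp flip: hom_minus)

lemma Int_mult: "u \<in> Int_poly \<iota> \<Longrightarrow> v \<in> Int_poly \<iota> \<Longrightarrow> u * v \<in> Int_poly \<iota>"
  unfolding Int_poly_def by (simp add: range_mult)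

lemma Int_const: "[:\<iota> r:] \<in> Int_poly \<iota>"
  unfolding Int_poly_def by auto

lemma Int_one: "1 \<in> Int_poly \<iota>"
  using Int_const[of 1] hom_one by (simp add: one_pCons)

lemma f_in_Int: "f \<in> Int_poly \<iota>"
  using coeffs_in_range_imp[OF f_coeffs] map_poly_in_Int by blast

lemma D_iff: "u \<in> D \<longleftrightarrow> u \<in> Int_poly \<iota> \<and> (\<exists>k. \<exists>h\<in>Int_poly \<iota>. f ^ k = u * h)"
  unfolding div_closed_def using f_nonzero by auto

lemma D_Int: "u \<in> D \<Longrightarrow> u \<in> Int_poly \<iota>"
  unfolding D_iff by blast

lemma D_M: "u \<in> D \<Longrightarrow> u \<in> M"
proof -
  assume "u \<in> D"
  then obtain k h where "f ^ k = u * h" unfolding D_iff by blast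
  then show ?thesis unfolding M_def by (intro CollectI exI[of _ k]) simp
qed

lemma D_nonzero: "u \<in> D \<Longrightarrow> u \<noteq> 0"
  using D_M M_nonzero by blast

lemma one_in_D: "1 \<in> D"
  unfolding D_iff using Int_one by (intro conjI exI[of _ 0] bexI[of _ 1]) auto

lemma D_I: "u \<in> Int_poly \<iota> \<Longrightarrow> h \<in> Int_poly \<iota> \<Longrightarrow> f ^ k = u * h \<Longrightarrow> u \<in> D"
  unfolding D_iff by blast

lemma D_mult:
  assumes "u \<in> D" "v \<in> D"
  shows "u * v \<in> D"
proof -
  obtain k h l h' where *: "u \<in> Int_poly \<iota>" "h \<in> Int_poly \<iota>" "f ^ k = u * h"
    "v \<in> Int_poly \<iota>" "h' \<in> Int_poly \<iota>" "f ^ l = v * h'"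
    using assms unfolding D_iff by blast
  then have "f ^ (k + l) = u * v * (h * h')" by (simp add: power_add)
  then show ?thesis using * by (intro D_I[of "u * v" "h * h'" "k + l"] Int_mult)
qed

lemma D_left_factor:
  assumes "u * v \<in> D" "u \<in> Int_poly \<iota>" "v \<in> Int_poly \<iota>"
  shows "u \<in> D"
proof -
  obtain k h where h: "h \<in> Int_poly \<iota>" "f ^ k = u * v * h" using assms(1) unfolding D_iff by blast
  then show ?thesis using assms by (intro D_I[of u "v * h" k] Int_mult) (auto simp: mult.assoc)
qed

lemma D_complement: "u \<in> D \<Longrightarrow> \<exists>v\<in>D. \<exists>k. u * v = f ^ k"
proof -
  assume "u \<in> D"
  then obtain k h where h: "h \<in> Int_poly \<iota>" "f ^ k = u * h" "u \<in> Int_poly \<iota>" unfolding D_iff by blast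
  then have "f ^ k \<in> D" unfolding D_iff
    by (intro conjI exI[of _ k] bexI[of _ 1]) (auto intro: Int_mult Int_one)
  then have "h \<in> D" using h D_left_factor[of h u] by (simp add: mult.commute)
  then show ?thesis using h \<open>f ^ k \<in> D\<close> by metis
qed

lemma f_in_D: "f \<in> D"
  unfolding D_iff using f_in_Int Int_one by (intro conjI exI[of _ 1] bexI[of _ 1]) auto

lemma D_power: "u \<in> D \<Longrightarrow> u ^ n \<in> D"
  by (induction n) (auto intro: D_mult one_in_D)

text \<open>As \<open>g\<close> is primitive, Gauss's lemma gives its cofactor in \<open>f\<close>
  coefficients in the ring, so the cofactor is integer-valued too.\<close>

lemma G_subset_D:
  assumes "g \<in> G"
  shows "g \<in> D"
proof -
  obtain v where v: "primitive v" "g = map_poly \<iota> v" using G_primitive[OF assms] by blast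
  obtain F where F: "f = map_poly \<iota> F" using coeffs_in_range_imp[OF f_coeffs] by blast
  have "v dvd F" using gauss[OF v(1)] G_dvd[OF assms] v(2) F by simp
  then obtain w where "F = v * w" by (elim dvdE)
  then have "f = g * map_poly \<iota> w" using F v(2) by (simp add: map_poly_mult)
  then show ?thesis using D_left_factor f_in_D map_poly_in_Int v(2) by metis
qed

lemma ev_Int: "u \<in> Int_poly \<iota> \<Longrightarrow> ev u c \<in> range \<iota>"
  unfolding Int_poly_def by blast

lemma val_ev_nonneg: "prime_elem p \<Longrightarrow> u \<in> D \<Longrightarrow> c \<in> nonroots \<Longrightarrow> 0 \<le> val p (ev u c)"
  using val_nonneg ev_M_nonzero D_M D_Int ev_Int by metis

lemma val_ev_mult:
  "prime_elem p \<Longrightarrow> u \<in> M \<Longrightarrow> v \<in> M \<Longrightarrow> c \<in> nonroots \<Longrightarrow>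
    val p (ev (u * v) c) = val p (ev u c) + val p (ev v c)"
  by (simp add: val_mult ev_M_nonzero)

lemma finite_roots:
  assumes "u \<noteq> 0"
  shows "finite {c. ev u c = 0}"
proof -
  have "\<iota> ` {c. ev u c = 0} \<subseteq> {z. poly u z = 0}" by auto
  then show ?thesis using poly_roots_finite[OF assms] inj_hom
    by (meson finite_imageD finite_subset inj_on_subset subset_UNIV)
qed

lemma dvd_poly_diff: "x - y dvd poly u x - poly u y" for u :: "'a poly"
proof (induction u)
  case (pCons a u)
  have "poly (pCons a u) x - poly (pCons a u) y = x * (poly u x - poly u y) + (x - y) * poly u y"
    by (simp add: algebra_simps)
  then show ?case using pCons.IH by (metis dvd_add dvd_mult dvd_triv_left)
qed simp

text \<open>Values at roots of \<open>f\<close> are controlled by those at nearby nonroots: if \<open>d u\<close> has coefficients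
  in the ring then \<open>u(c + d m) - u(c)\<close> lies in the ring.\<close>

lemma in_Int_of_nonroots:
  assumes "\<And>c. c \<in> nonroots \<Longrightarrow> ev u c \<in> range \<iota>"
  shows "u \<in> Int_poly \<iota>"
proof -
  have "ev u c \<in> range \<iota>" for c
  proof (cases "infinite (UNIV :: 'a set)")
    case True
    obtain d v where dv: "d \<noteq> 0" "smult (\<iota> d) u = map_poly \<iota> v" using exists_common_denominator by blast
    have fin: "finite {c. ev f c = 0}" using finite_roots[OF f_nonzero] .
    \<comment> \<open>The progression \<open>c + d * m\<close> is infinite and therefore leaves the
      finite zero set of \<open>f\<close>.\<close>
    have "inj (\<lambda>m. c + d * m)" using dv(1) by (auto intro: injI)
    then have "infinite (range (\<lambda>m. c + d * m))" using True by (simp add: finite_image_iff)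
    then obtain c' where "c' \<in> range (\<lambda>m. c + d * m)" "c' \<notin> {c. ev f c = 0}"
      using fin finite_subset subsetI by metis
    then obtain m where m: "c + d * m \<in> nonroots" unfolding nonroots_def by blast
    have "(c + d * m) - c dvd poly v (c + d * m) - poly v c" by (rule dvd_poly_diff)
    then have "d dvd poly v (c + d * m) - poly v c" using dvd_mult_left[of d m] by simp
    then obtain e where e: "poly v (c + d * m) - poly v c = d * e" by (elim dvdE)
    have "\<iota> d * ev u x = \<iota> (poly v x)" for x
      using dv(2) poly_map_poly[of v x] by (metis poly_smult)
    then have "\<iota> d * (ev u (c + d * m) - ev u c) = \<iota> d * \<iota> e"
      using e by (metis hom_minus hom_mult right_diff_distrib)
    then have "ev u (c + d * m) - ev u c = \<iota> e" using dv(1) hom_eq_zero_iff by simp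
    then have "ev u c = ev u (c + d * m) - \<iota> e" by (simp add: algebra_simps)
    then show ?thesis using assms[OF m] range_diff by simp
  next
    case False
    \<comment> \<open>A finite ring is its own quotient field, so every value is admissible.\<close>
    then show ?thesis using infinite_or_surj by (metis UNIV_I)
  qed
  then show ?thesis unfolding Int_poly_def by blast
qed

lemma M_in_Int:
  assumes "u \<in> M" "\<And>p c. prime p \<Longrightarrow> c \<in> nonroots \<Longrightarrow> 0 \<le> val p (ev u c)"
  shows "u \<in> Int_poly \<iota>"
  using assms in_range_iff_val_nonneg ev_M_nonzero by (intro in_Int_of_nonroots) blast

lemma exists_nonroot:
  assumes "prime_elem (p :: 'a)"
  shows "nonroots \<noteq> {}"
proof -
  have "infinite (UNIV :: 'a set)" using prime_elem_imp_infinite_UNIV[OF assms] .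
  then show ?thesis using finite_roots[OF f_nonzero] unfolding nonroots_def by force
qed

section \<open>Primes of the ring that divide a power of f in Int(R)\<close>

definition fixed_primes :: "'a set" where
  "fixed_primes = {p. prime p \<and> [:\<iota> p:] \<in> D}"

lemma fixed_prime_elem: "p \<in> fixed_primes \<Longrightarrow> prime_elem p"
  unfolding fixed_primes_def by auto

lemma val_normalize: "val (normalize p) z = val p z"
  unfolding val_def by simp

text \<open>Division by \<open>p ^ n\<close> lowers only the valuation at the prime associated to
  \<open>p\<close>, and there by exactly \<open>n\<close>. So the quotient is integer-valued, and
  both factors divide a power of \<open>f\<close>.\<close>

lemma divide_const_in_Int:
  assumes p: "prime_elem p" and u: "u \<in> D"
    and le: "\<And>c. c \<in> nonroots \<Longrightarrow> int n \<le> val p (ev u c)"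
  shows "\<exists>v\<in>D. u = [:\<iota> (p ^ n):] * v \<and> [:\<iota> (p ^ n):] \<in> D"
proof -
  have p0: "\<iota> (p ^ n) \<noteq> 0" using p hom_eq_zero_iff by auto
  define v where "v = smult (inverse (\<iota> (p ^ n))) u"
  have uv: "[:\<iota> (p ^ n):] * v = u" unfolding v_def using p0 by simp
  then have vM: "v \<in> M" using M_dvd[OF D_M[OF u]] by (metis dvd_triv_right)
  have "v \<in> Int_poly \<iota>"
  proof (rule M_in_Int[OF vM])
    fix q c :: 'a assume q: "prime q" and c: "c \<in> nonroots"
    have qe: "prime_elem q" using q by auto
    have "ev u c = \<iota> (p ^ n) * ev v c" using arg_cong[OF uv, of "\<lambda>u. ev u c"] by simp
    then have eq: "val q (ev u c) = val q (\<iota> (p ^ n)) + val q (ev v c)"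
      using val_mult[OF qe p0 ev_M_nonzero[OF vM c]] by simp
    have val_p: "val q (\<iota> (p ^ n)) = int n * int (multiplicity q p)"
      using p val_hom[OF qe, of "p ^ n"] by (auto simp: prime_elem_multiplicity_power_distrib[OF qe])
    show "0 \<le> val q (ev v c)"
    proof (cases "q = normalize p")
      case True
      then have "multiplicity q p = 1" using p by simp
      moreover have "int n \<le> val q (ev u c)" using le[OF c] True val_normalize by simp
      ultimately show ?thesis using eq val_p by simp
    next
      case False
      have "prime (normalize p)" using p by simp
      then have "\<not> q dvd normalize p" using False q primes_dvd_imp_eq by blast
      then have "multiplicity q p = 0" using not_dvd_imp_multiplicity_0[of q p] by simp
      then show ?thesis using eq val_p val_ev_nonneg[OF qe u c] by simp
    qed
  qed
  then show ?thesis
    using D_left_factor[of "[:\<iota> (p ^ n):]" v] D_left_factor[of v "[:\<iota> (p ^ n):]"] Int_const uv u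
    by (metis mult.commute)
qed

text \<open>If \<open>p\<close> divided the values of \<open>f\<close> at all nonroots, the quotient
  of \<open>f\<close> by \<open>p\<close> would be integer-valued and \<open>p\<close> would be a
  fixed prime.\<close>

lemma exists_unramified_nonroot:
  assumes p: "prime p" "p \<notin> fixed_primes"
  shows "\<exists>c\<in>nonroots. val p (ev f c) = 0"
proof (rule ccontr)
  assume neg: "\<not> ?thesis"
  have pe: "prime_elem p" using p by auto
  have "int 1 \<le> val p (ev f c)" if "c \<in> nonroots" for c
    using val_ev_nonneg[OF pe f_in_D that] neg that by force
  then have "[:\<iota> (p ^ 1):] \<in> D" using divide_const_in_Int[OF pe f_in_D] by blast
  then show False using p unfolding fixed_primes_def by simp
qed

text \<open>Evaluation at a single nonroot \<open>c\<close> shows that every fixed prime divides one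
  nonzero ring element, the value of \<open>f\<close> at \<open>c\<close>.\<close>

lemma finite_fixed_primes: "finite fixed_primes"
proof (cases "fixed_primes = {}")
  case False
  then obtain c where c: "c \<in> nonroots" using exists_nonroot fixed_prime_elem by blast
  obtain r where r: "ev f c = \<iota> r" using ev_Int[OF f_in_Int] by blast
  then have r0: "r \<noteq> 0" using c hom_zero unfolding nonroots_def by auto
  have "fixed_primes \<subseteq> prime_factors r"
  proof
    fix p assume p: "p \<in> fixed_primes"
    then obtain k h where h: "h \<in> Int_poly \<iota>" "f ^ k = [:\<iota> p:] * h"
      unfolding fixed_primes_def D_iff by blast
    obtain s where s: "ev h c = \<iota> s" using ev_Int[OF h(1)] by blast
    have "ev (f ^ k) c = ev ([:\<iota> p:] * h) c" using h(2) by simp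
    then have "\<iota> (r ^ k) = \<iota> (p * s)" using r s by (simp add: hom_power hom_mult)
    then have "p dvd r ^ k" using hom_eq_iff by simp
    then have "p dvd r" using prime_elem_dvd_power fixed_prime_elem[OF p] by blast
    then show "p \<in> prime_factors r" using p r0 by (simp add: fixed_primes_def in_prime_factors_iff)
  qed
  then show ?thesis using finite_subset by blast
qed simp

section \<open>The valuations cutting out the monoid\<close>

definition point_val :: "'a \<Rightarrow> 'a \<Rightarrow> 'k poly fract \<Rightarrow> int" where
  "point_val p c x = (THE k. \<exists>a\<in>M. \<exists>b\<in>M. x = to_fract a / to_fract b \<and>
     k = val p (ev a c) - val p (ev b c))"

text \<open>Numerators and denominators from \<open>M\<close> do not vanish at the nonroot
  \<open>c\<close>. Cross-multiplying and evaluating at \<open>c\<close> shows that the choice of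
  the fraction is immaterial.\<close>

lemma point_val_fraction:
  assumes p: "prime_elem p" and c: "c \<in> nonroots" and ab: "a \<in> M" "b \<in> M"
  shows "point_val p c (to_fract a / to_fract b) = val p (ev a c) - val p (ev b c)"
  unfolding point_val_def
proof (rule the_equality)
  fix k
  assume "\<exists>a'\<in>M. \<exists>b'\<in>M. to_fract a / to_fract b = to_fract a' / to_fract b' \<and>
    k = val p (ev a' c) - val p (ev b' c)"
  then obtain a' b' where *: "a' \<in> M" "b' \<in> M" "to_fract a / to_fract b = to_fract a' / to_fract b'"
    "k = val p (ev a' c) - val p (ev b' c)" by blast
  then have "to_fract (a * b') = to_fract (a' * b)"
    using M_nonzero[OF ab(2)] M_nonzero[OF *(2)] by (simp add: frac_eq_eq)
  then have "a * b' = a' * b" by (simp only: to_fract_eq_iff)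
  then have "val p (ev a c) + val p (ev b' c) = val p (ev a' c) + val p (ev b c)"
    using val_ev_mult[OF p _ _ c] ab *(1,2) by metis
  then show "k = val p (ev a c) - val p (ev b c)" using *(4) by simp
qed (use ab in blast)

lemma point_val_to_fract:
  assumes "prime_elem p" "c \<in> nonroots" "a \<in> M"
  shows "point_val p c (to_fract a) = val p (ev a c)"
  using point_val_fraction[OF assms D_M[OF one_in_D]] val_hom[OF assms(1), of 1] hom_one by simp

abbreviation L where "L \<equiv> quotient_group H"

lemma to_fract_in_H_iff: "to_fract u \<in> H \<longleftrightarrow> u \<in> D"
  unfolding div_monoid_def by auto

lemma H_cases:
  assumes "x \<in> H"
  obtains u where "u \<in> D" "x = to_fract u"
  using assms unfolding div_monoid_def by blast

lemma L_cases:
  assumes "x \<in> L"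
  obtains a b where "a \<in> D" "b \<in> D" "x = to_fract a / to_fract b"
  using assms unfolding quotient_group_def div_monoid_def by blast

lemma L_fraction: "a \<in> D \<Longrightarrow> b \<in> D \<Longrightarrow> to_fract a / to_fract b \<in> L"
  unfolding quotient_group_def using to_fract_in_H_iff by blast

lemma L_to_fract: "a \<in> D \<Longrightarrow> to_fract a \<in> L"
  using L_fraction[OF _ one_in_D] by simp

lemma L_nonzero: "x \<in> L \<Longrightarrow> x \<noteq> 0"
  by (elim L_cases) (simp add: D_nonzero)

definition W :: "('k poly fract \<Rightarrow> int) set" where
  "W = fract_val ` G \<union> (\<Union>p\<in>fixed_primes. point_val p ` T p)"

lemma W_cases:
  assumes "w \<in> W"
  obtains g where "g \<in> G" "w = fract_val g"
    | p t where "p \<in> fixed_primes" "t \<in> T p" "w = point_val p t"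
  using assms unfolding W_def by blast

lemma fract_val_fraction:
  assumes "irreducible g" "a \<in> D" "b \<in> D"
  shows "fract_val g (to_fract a / to_fract b) = int (poly_val g a) - int (poly_val g b)"
  using fract_val_Fract[OF assms(1)] assms D_nonzero by (simp add: Fract_conv_to_fract)

lemma W_mult:
  assumes w: "w \<in> W" and xy: "x \<in> L" "y \<in> L"
  shows "w (x * y) = w x + w y"
  using w
proof (cases rule: W_cases)
  case (1 g)
  then show ?thesis using fract_val_mult[OF G_irreducible] L_nonzero xy by blast
next
  case (2 p t)
  obtain a b c d where *: "a \<in> D" "b \<in> D" "x = to_fract a / to_fract b"
    "c \<in> D" "d \<in> D" "y = to_fract c / to_fract d"
    using xy by (elim L_cases)
  then have "x * y = to_fract (a * c) / to_fract (b * d)" by simp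
  moreover have pe: "prime_elem p" and tn: "t \<in> nonroots" using 2 fixed_prime_elem T_subset by blast+
  ultimately show ?thesis
    using * 2(3)
    by (simp add: point_val_fraction[OF pe tn] D_M M_mult val_ev_mult[OF pe _ _ tn]
        del: poly_mult to_fract_mult)
qed

lemma W_nonneg:
  assumes w: "w \<in> W" and x: "x \<in> H"
  shows "0 \<le> w x"
proof -
  obtain u where u: "u \<in> D" "x = to_fract u" using x by (elim H_cases)
  from w show ?thesis
  proof (cases rule: W_cases)
    case (1 g)
    then show ?thesis using u by (simp add: fract_val_to_fract G_irreducible D_nonzero)
  next
    case (2 p t)
    then have pe: "prime_elem p" and tn: "t \<in> nonroots" using fixed_prime_elem T_subset by blast+
    show ?thesis
      using u 2(3) by (simp add: point_val_to_fract[OF pe tn] D_M val_ev_nonneg[OF pe _ tn])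
  qed
qed

text \<open>The \<open>g\<close>-adic conditions make the quotient \<open>u\<close> a polynomial. At
  a fixed prime it is integral because the points of \<open>T p\<close> bound its values at all
  nonroots from below; at any other prime a point where \<open>f\<close> has value 0 plays this
  part.\<close>

lemma in_H_of_W_nonneg:
  assumes x: "x \<in> L" and nn: "\<And>w. w \<in> W \<Longrightarrow> 0 \<le> w x"
  shows "x \<in> H"
proof -
  obtain a b where ab: "a \<in> D" "b \<in> D" "x = to_fract a / to_fract b" using x by (elim L_cases)
  have "b dvd a"
  proof (rule M_dvd_of_poly_val_le[OF D_M[OF ab(2)] D_nonzero[OF ab(1)]])
    fix g assume g: "g \<in> G"
    then have "0 \<le> fract_val g x" using nn unfolding W_def by blast
    then show "poly_val g b \<le> poly_val g a"
      using ab fract_val_fraction[OF G_irreducible[OF g]] by simp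
  qed
  then obtain u where u: "a = b * u" by (elim dvdE)
  have uM: "u \<in> M" using M_dvd[OF D_M[OF ab(1)]] u by simp
  have diff: "val p (ev u c) = val p (ev a c) - val p (ev b c)"
    if "prime_elem p" "c \<in> nonroots" for p c
    using val_ev_mult[OF that(1) D_M[OF ab(2)] uM that(2)] u by simp
  have "u \<in> Int_poly \<iota>"
  proof (rule M_in_Int[OF uM])
    fix p c :: 'a assume p: "prime p" and c: "c \<in> nonroots"
    have pe: "prime_elem p" using p by auto
    show "0 \<le> val p (ev u c)"
    proof (cases "p \<in> fixed_primes")
      case True
      obtain t where t: "t \<in> T p" "val p (ev u t) \<le> val p (ev u c)"
        using T_minimal[OF pe c] uM by blast
      have "0 \<le> point_val p t x" using nn True t(1) unfolding W_def by blast
      then show ?thesis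
        using t(2) ab(3) diff[OF pe T_subset[OF pe t(1)]]
          point_val_fraction[OF pe T_subset[OF pe t(1)] D_M[OF ab(1)] D_M[OF ab(2)]] by simp
    next
      case False
      then obtain s where s: "s \<in> nonroots" "val p (ev f s) = 0"
        using exists_unramified_nonroot[OF p] by blast
      \<comment> \<open>Complementary divisors of \<open>f ^ k\<close> have nonnegative valuations
        at \<open>s\<close> with sum 0. So \<open>s\<close> is minimal for \<open>G\<close>, hence
        for \<open>M\<close>, and \<open>u\<close> has valuation 0 there.\<close>
      have zero: "val p (ev h s) = 0" if h: "h \<in> D" for h
      proof -
        obtain h' k where h': "h' \<in> D" "h * h' = f ^ k" using D_complement[OF h] by blast
        have "val p (ev h s) + val p (ev h' s) = val p (ev (f ^ k) s)"
          using val_ev_mult[OF pe D_M[OF h] D_M[OF h'(1)] s(1)] h'(2) by simp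
        also have "\<dots> = 0" using s val_power[OF pe, of "ev f s" k] by (simp add: nonroots_def)
        finally show ?thesis
          using val_ev_nonneg[OF pe h s(1)] val_ev_nonneg[OF pe h'(1) s(1)] by simp
      qed
      have "val p (ev u s) \<le> val p (ev u c)"
      proof (rule val_ev_mono[OF pe c s(1) _ uM])
        fix g assume g: "g \<in> G"
        show "val p (ev g s) \<le> val p (ev g c)"
          using zero[OF G_subset_D[OF g]] val_ev_nonneg[OF pe G_subset_D[OF g] c] by simp
      qed
      then show ?thesis using diff[OF pe s(1)] zero ab by simp
    qed
  qed
  then have "u \<in> D" using D_left_factor[of u b] u ab(1) D_Int[OF ab(2)] by (simp add: mult.commute)
  moreover have "x = to_fract u" using ab(3) u D_nonzero[OF ab(2)] by simp
  ultimately show ?thesis using to_fract_in_H_iff by simp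
qed

lemma point_val_const:
  assumes "prime_elem p" "t \<in> nonroots" "r \<noteq> 0"
  shows "point_val p t (to_fract [:\<iota> r:]) = int (multiplicity p r)"
  using assms point_val_to_fract[OF assms(1,2) M_const] val_hom hom_eq_zero_iff by simp

lemma W_normalized:
  assumes w: "w \<in> W"
  shows "\<exists>x\<in>L. w x = 1"
  using w
proof (cases rule: W_cases)
  case (1 g)
  then have "w (to_fract g) = 1"
    using fract_val_to_fract[of g g] G_irreducible[OF 1(1)] irreducible_poly_not_unit[of g]
    by (simp add: poly_val_self)
  then show ?thesis using L_to_fract[OF G_subset_D[OF 1(1)]] by blast
next
  case (2 p t)
  have pe: "prime_elem p" using fixed_prime_elem[OF 2(1)] .
  then have "w (to_fract [:\<iota> p:]) = 1"
    using point_val_const[OF pe T_subset[OF pe 2(2)], of p] 2(3) by auto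
  then show ?thesis using L_to_fract 2(1) unfolding fixed_primes_def by blast
qed

sublocale W: finite_valuation_monoid H W
proof
  show "1 \<in> H" using to_fract_in_H_iff[of 1] one_in_D by simp
  show "0 \<notin> H" using D_nonzero by (auto elim: H_cases)
  show "x * y \<in> H" if "x \<in> H" "y \<in> H" for x y
    using that by (elim H_cases) (simp add: to_fract_in_H_iff D_mult flip: to_fract_mult)
  show "finite W" unfolding W_def
    using finite_G finite_fixed_primes finite_T fixed_prime_elem by blast
  show "x \<in> H \<longleftrightarrow> (\<forall>w\<in>W. 0 \<le> w x)" if "x \<in> L" for x
    using W_nonneg in_H_of_W_nonneg[OF that] by blast
  show "w (x * y) = w x + w y" if "w \<in> W" "x \<in> L" "y \<in> L" for w x y
    using W_mult that .
  show "\<exists>x\<in>L. w x = 1" if "w \<in> W" for w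
    using W_normalized that .
qed

section \<open>Essential valuations\<close>

definition V :: "('k poly fract \<Rightarrow> int) set" where
  "V = (SOME V. V \<subseteq> W \<and> finite_krull_monoid H V)"

lemma V_properties: "V \<subseteq> W \<and> finite_krull_monoid H V"
  unfolding V_def by (rule someI_ex[OF W.exists_finite_krull_monoid])

sublocale V: finite_krull_monoid H V
  using V_properties by blast

lemma V_subset_W: "w \<in> V \<Longrightarrow> w \<in> W"
  using V_properties by blast

lemma prod_fixed_primes_in_D: "[:\<iota> ((\<Prod>p\<in>fixed_primes. p) ^ n):] \<in> D"
proof -
  have "[:\<iota> (\<Prod>p\<in>A. p):] \<in> D" if "finite A" "A \<subseteq> fixed_primes" for A
    using that
  proof (induction A rule: finite_induct)
    case empty
    then show ?case using one_in_D hom_one by (simp add: one_pCons)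
  next
    case (insert p A)
    have "[:\<iota> p:] * [:\<iota> (\<Prod>p\<in>A. p):] \<in> D"
      using insert by (intro D_mult) (auto simp: fixed_primes_def)
    then show ?case using insert.hyps by (simp add: hom_mult mult.commute)
  qed
  then have "[:\<iota> (\<Prod>p\<in>fixed_primes. p):] ^ n \<in> D" using finite_fixed_primes D_power by blast
  moreover have "[:\<iota> r:] ^ n = [:\<iota> (r ^ n):]" for r
    by (induction n) (simp_all add: hom_one hom_mult one_pCons)
  ultimately show ?thesis by simp
qed

text \<open>Without the valuation of \<open>g\<close> the fraction \<open>r / g\<close>, for \<open>r\<close> a high power of the product of all
  fixed primes, would be nonnegative everywhere and hence a multiple of \<open>1 / g\<close> inside the monoid.\<close>

lemma fract_val_in_V:
  assumes g: "g \<in> G"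
  shows "fract_val g \<in> V"
proof (rule ccontr)
  assume notin: "fract_val g \<notin> V"
  have irr: "irreducible g" using G_irreducible[OF g] .
  define S where "S = (\<Union>p\<in>fixed_primes. (\<lambda>t. nat (val p (ev g t))) ` T p)"
  have "finite S" unfolding S_def using finite_fixed_primes finite_T fixed_prime_elem by blast
  \<comment> \<open>\<open>N\<close> bounds the values of \<open>g\<close> in all point valuations
    of \<open>W\<close>, so the numerator \<open>r\<close> compensates the denominator
    \<open>g\<close> in each of them.\<close>
  then obtain N where N: "\<And>n. n \<in> S \<Longrightarrow> n \<le> N" by (meson finite_nat_set_iff_bounded_le)
  define r where "r = (\<Prod>p\<in>fixed_primes. p) ^ N"
  have "0 \<notin> fixed_primes" using fixed_prime_elem[of 0] by auto
  then have r0: "r \<noteq> 0" unfolding r_def using finite_fixed_primes by simp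
  have rD: "[:\<iota> r:] \<in> D" unfolding r_def by (rule prod_fixed_primes_in_D)
  have ir0: "\<iota> r \<noteq> 0" using r0 hom_eq_zero_iff by simp
  define x where "x = to_fract [:\<iota> r:] / to_fract g"
  have xL: "x \<in> L" unfolding x_def using L_fraction[OF rD G_subset_D[OF g]] .
  have val_x: "fract_val h x = - int (poly_val h g)" if "h \<in> G" for h
    unfolding x_def using fract_val_fraction[OF _ rD G_subset_D[OF g], of h] G_irreducible[OF that]
      poly_val_const[OF _ ir0, of h] by simp
  have "0 \<le> w x" if w: "w \<in> V" for w
    using V_subset_W[OF w]
  proof (cases rule: W_cases)
    case (1 h)
    then have "h \<noteq> g" using notin w by blast
    then have "\<not> h dvd g" using G_dvd_imp_eq 1(1) g by blast
    then have "poly_val h g = 0"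
      using poly_val_not_dvd irreducible_poly_not_unit[OF G_irreducible[OF 1(1)]] by blast
    then show ?thesis using val_x[OF 1(1)] 1(2) by simp
  next
    case (2 p t)
    have pe: "prime_elem p" using fixed_prime_elem[OF 2(1)] .
    have tn: "t \<in> nonroots" using T_subset[OF pe 2(2)] .
    have "nat (val p (ev g t)) \<in> S" unfolding S_def using 2(1,2) by blast
    then have "val p (ev g t) \<le> int N" using N by fastforce
    moreover have "p ^ N dvd r"
      unfolding r_def using finite_fixed_primes 2(1) by (intro dvd_power_same dvd_prodI)
    then have "N \<le> multiplicity p r"
      using r0 pe by (intro multiplicity_geI) (auto simp: prime_elem_def)
    moreover have "w x = val p (\<iota> r) - val p (ev g t)"
      unfolding 2(3) x_def using point_val_fraction[OF pe tn D_M[OF rD] G_subset_M[OF g]] by simp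
    ultimately show ?thesis using val_hom[OF pe r0] by simp
  qed
  then have "x \<in> H" using V.in_iff[OF xL] by blast
  then have "0 \<le> fract_val g x" using W_nonneg g unfolding W_def by blast
  then show False using val_x[OF g] poly_val_self[OF irr] by simp
qed

section \<open>The ideals P_g\<close>

definition poly_exponents :: "'k poly \<Rightarrow> ('k poly fract \<Rightarrow> int) \<Rightarrow> int" where
  "poly_exponents g w = (if w \<in> fract_val ` G then w (to_fract g) else 0)"

lemma to_fract_in_P_ideal_iff: "to_fract a \<in> P_ideal \<iota> f g \<longleftrightarrow> a \<in> D \<and> g dvd a"
proof -
  have "to_fract a \<in> P_ideal \<iota> f g \<longleftrightarrow> a \<in> range ((*) g) \<inter> D"
    unfolding P_ideal_def by (intro inj_image_mem_iff injI) simp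
  then show ?thesis by (auto elim!: dvdE)
qed

text \<open>Divisibility by \<open>g\<close> in \<open>K[X]\<close> is tested by the valuations of
  the elements of \<open>G\<close>, all of which are essential. The remaining valuations only have
  to ensure membership in the monoid, whence the zeros in \<open>poly_exponents\<close>.\<close>

lemma P_ideal_eq_div_ideal:
  assumes g: "g \<in> D"
  shows "P_ideal \<iota> f g = V.div_ideal (poly_exponents g)"
proof (intro set_eqI iffI)
  fix x assume "x \<in> P_ideal \<iota> f g"
  then obtain u where u: "x = to_fract (g * u)" "g * u \<in> D" unfolding P_ideal_def by blast
  have u0: "u \<noteq> 0" "g \<noteq> 0" using D_nonzero[OF u(2)] by auto
  have "poly_exponents g w \<le> w x" if w: "w \<in> V" for w
  proof (cases "w \<in> fract_val ` G")
    case True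
    then obtain h where h: "h \<in> G" "w = fract_val h" by blast
    then show ?thesis unfolding poly_exponents_def u(1)
      using u0 by (simp add: fract_val_to_fract poly_val_mult G_irreducible del: to_fract_mult)
  next
    case False
    then show ?thesis unfolding poly_exponents_def 
      using W_nonneg[OF V_subset_W[OF w]] u by (simp add: to_fract_in_H_iff del: to_fract_mult)
  qed
  then show "x \<in> V.div_ideal (poly_exponents g)"
    unfolding V.div_ideal_def using u L_to_fract by blast
next
  fix x assume x: "x \<in> V.div_ideal (poly_exponents g)"
  then have xL: "x \<in> L" and le: "\<And>w. w \<in> V \<Longrightarrow> poly_exponents g w \<le> w x"
    unfolding V.div_ideal_def by auto
  have "0 \<le> poly_exponents g w" if "w \<in> V" for w
    unfolding poly_exponents_def using W_nonneg[OF V_subset_W[OF that]] g to_fract_in_H_iff by simp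
  then have "x \<in> H" using V.in_iff[OF xL] le by force
  then obtain a where a: "a \<in> D" "x = to_fract a" by (elim H_cases)
  have "g dvd a"
  proof (rule M_dvd_of_poly_val_le[OF D_M[OF g] D_nonzero[OF a(1)]])
    fix h assume h: "h \<in> G"
    then have "fract_val h (to_fract g) \<le> fract_val h x"
      using le[OF fract_val_in_V[OF h]] unfolding poly_exponents_def by auto
    then show "poly_val h g \<le> poly_val h a"
      using a g h by (simp add: fract_val_to_fract G_irreducible D_nonzero)
  qed
  then show "x \<in> P_ideal \<iota> f g" using a to_fract_in_P_ideal_iff by simp
qed

lemma v_closure_P_ideal_mult:
  assumes g: "g \<in> D" and h: "h \<in> D"
  shows "v_closure H (P_ideal \<iota> f g * P_ideal \<iota> f h) = P_ideal \<iota> f (g * h)"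
proof -
  have "v_closure H (P_ideal \<iota> f g * P_ideal \<iota> f h)
      = V.div_ideal (\<lambda>w. poly_exponents g w + poly_exponents h w)"
    unfolding P_ideal_eq_div_ideal[OF g] P_ideal_eq_div_ideal[OF h]
    by (intro V.v_closure_attains V.attains_mult V.attains_div_ideal)
  also have "\<dots> = V.div_ideal (poly_exponents (g * h))"
    using g h V_subset_W L_to_fract by (intro V.div_ideal_cong) (simp add: poly_exponents_def W_mult)
  finally show ?thesis using P_ideal_eq_div_ideal[OF D_mult[OF g h]] by simp
qed

text \<open>The given \<open>g\<close> is replaced by its associate \<open>b\<close> in
  \<open>G\<close>, which has the same valuation. The prime of \<open>fract_val b\<close> is the
  ideal of multiples of \<open>g\<close>, and there the exponents of principal ideals are
  known.\<close>

lemma v_exponent_P_ideal: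
  assumes g: "g \<in> D" "irreducible g" and x: "x \<in> L"
  shows "v_exponent H (P_ideal \<iota> f g) ({x} * H) = fract_val g x"
proof -
  obtain k h where "f ^ k = g * h" using g(1) unfolding D_iff by blast
  then have "g dvd f"
    using prime_elem_dvd_power[OF field_poly_irreducible_imp_prime[OF g(2)]] by (metis dvd_triv_left)
  then obtain b where b: "b \<in> G" "b dvd g" "g dvd b" using G_represents[OF g(2)] by blast
  have irr: "irreducible b" using G_irreducible[OF b(1)] .
  have eq: "fract_val g = fract_val b" using fract_val_associated b by blast
  have "V.val_prime (fract_val b) = P_ideal \<iota> f g"
  proof (intro set_eqI iffI)
    fix y assume "y \<in> V.val_prime (fract_val b)"
    then have y: "y \<in> H" "0 < fract_val b y" unfolding V.val_prime_def by auto
    then obtain a where a: "a \<in> D" "y = to_fract a" by (elim H_cases)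
    then have "1 \<le> poly_val b a" using y(2) fract_val_to_fract[OF irr D_nonzero[OF a(1)]] by simp
    then have "b dvd a" using le_poly_val_iff[OF irr D_nonzero[OF a(1)], of 1] by simp
    then have "g dvd a" using b(3) dvd_trans by blast
    then show "y \<in> P_ideal \<iota> f g" using a to_fract_in_P_ideal_iff by simp
  next
    fix y assume "y \<in> P_ideal \<iota> f g"
    then obtain u where u: "y = to_fract (g * u)" "g * u \<in> D" unfolding P_ideal_def by blast
    have "b dvd g * u" using b(2) by simp
    then have "1 \<le> poly_val b (g * u)" using le_poly_val_iff[OF irr D_nonzero[OF u(2)], of 1] by simp
    then show "y \<in> V.val_prime (fract_val b)"
      unfolding V.val_prime_def using u fract_val_to_fract[OF irr D_nonzero[OF u(2)]] to_fract_in_H_iff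
      by (simp del: to_fract_mult)
  qed
  then show ?thesis using V.v_exponent_principal[OF fract_val_in_V[OF b(1)] x] eq by simp
qed

section \<open>Exponents of fixed divisors\<close>

definition min_val :: "'a \<Rightarrow> 'k poly \<Rightarrow> nat" where
  "min_val p u = the_enat (INF c. adic_val p (inv \<iota> (ev u c)))"

lemma min_val_cong: "(\<And>x. multiplicity p x = multiplicity q x) \<Longrightarrow> min_val p u = min_val q u"
  unfolding min_val_def adic_val_def by presburger

lemma hom_inv_ev: "u \<in> D \<Longrightarrow> \<iota> (inv \<iota> (ev u c)) = ev u c"
  by (rule f_inv_into_f[OF ev_Int[OF D_Int]])

lemma adic_val_ev:
  assumes "prime_elem p" "u \<in> D" "ev u c \<noteq> 0"
  shows "\<exists>k. adic_val p (inv \<iota> (ev u c)) = enat k \<and> val p (ev u c) = int k"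
proof -
  have "inv \<iota> (ev u c) \<noteq> 0" using hom_inv_ev[OF assms(2), of c] assms(3) hom_zero by metis
  then show ?thesis
    using val_hom[OF assms(1), of "inv \<iota> (ev u c)"] hom_inv_ev[OF assms(2), of c]
    by (simp add: adic_val_def)
qed

text \<open>Zeros of \<open>u\<close> contribute \<infinity>, but a nonroot makes the infimum
  finite, so \<open>the_enat\<close> in \<open>min_val\<close> loses nothing.\<close>

lemma enat_min_val:
  assumes p: "prime_elem p" and u: "u \<in> D"
  shows "enat (min_val p u) = (INF c. adic_val p (inv \<iota> (ev u c)))"
proof -
  obtain c where c: "c \<in> nonroots" using exists_nonroot[OF p] by blast
  then obtain k where "adic_val p (inv \<iota> (ev u c)) = enat k"
    using adic_val_ev[OF p u ev_M_nonzero[OF D_M[OF u] c]] by blast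
  then have "(INF c. adic_val p (inv \<iota> (ev u c))) \<le> enat k" by (metis INF_lower UNIV_I)
  then show ?thesis unfolding min_val_def by (metis enat_ile the_enat.simps)
qed

lemma min_val_le:
  assumes p: "prime_elem p" and u: "u \<in> D" and c: "c \<in> nonroots"
  shows "int (min_val p u) \<le> val p (ev u c)"
proof -
  obtain k where k: "adic_val p (inv \<iota> (ev u c)) = enat k" "val p (ev u c) = int k"
    using adic_val_ev[OF p u ev_M_nonzero[OF D_M[OF u] c]] by blast
  have "enat (min_val p u) \<le> enat k"
    unfolding enat_min_val[OF p u] k(1)[symmetric] by (rule INF_lower) simp
  then show ?thesis using k(2) by simp
qed

text \<open>The bound at nonroots makes the quotient of \<open>u\<close> by \<open>p ^ n\<close>
  integer-valued; then \<open>p ^ n\<close> divides the value of \<open>u\<close> at every point,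
  zeros of \<open>f\<close> included.\<close>

lemma le_min_val:
  assumes p: "prime_elem p" and u: "u \<in> D"
    and le: "\<And>c. c \<in> nonroots \<Longrightarrow> int n \<le> val p (ev u c)"
  shows "n \<le> min_val p u"
proof -
  obtain v where v: "v \<in> D" "u = [:\<iota> (p ^ n):] * v" using divide_const_in_Int[OF p u le] by blast
  have "enat n \<le> adic_val p (inv \<iota> (ev u c))" for c
  proof (cases "inv \<iota> (ev u c) = 0")
    case False
    have "\<iota> (inv \<iota> (ev u c)) = \<iota> (p ^ n * inv \<iota> (ev v c))"
      using hom_inv_ev[OF u] hom_inv_ev[OF v(1)] v(2) by (simp add: hom_mult)
    then have "p ^ n dvd inv \<iota> (ev u c)" using hom_eq_iff by simp
    then have "n \<le> multiplicity p (inv \<iota> (ev u c))"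
      using False p by (intro multiplicity_geI) (auto simp: prime_elem_def)
    then show ?thesis using False by (simp add: adic_val_def)
  qed (simp add: adic_val_def)
  then have "enat n \<le> enat (min_val p u)" unfolding enat_min_val[OF p u] by (intro INF_greatest)
  then show ?thesis by simp
qed

lemma min_val_mult_ge:
  assumes p: "prime_elem p" and g: "g \<in> D" and h: "h \<in> D"
  shows "min_val p h \<le> min_val p (g * h)"
proof (rule le_min_val[OF p D_mult[OF g h]])
  fix c assume c: "c \<in> nonroots"
  show "int (min_val p h) \<le> val p (ev (g * h) c)"
    using min_val_le[OF p h c] val_ev_mult[OF p D_M[OF g] D_M[OF h] c] val_ev_nonneg[OF p g c] by simp
qed

lemma normalize_in_fixed_primes:
  assumes p: "prime_elem p" and "[:\<iota> p:] \<in> D"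
  shows "normalize p \<in> fixed_primes"
proof -
  have "p = normalize p * unit_factor p" by simp
  then have "[:\<iota> (normalize p):] * [:\<iota> (unit_factor p):] = [:\<iota> p:]"
    using hom_mult[of "normalize p" "unit_factor p"] by (simp add: mult.commute)
  then have "[:\<iota> (normalize p):] \<in> D" using D_left_factor Int_const assms(2) by metis
  then show ?thesis unfolding fixed_primes_def using p by simp
qed

text \<open>A prime dividing all values of \<open>u\<close> divides \<open>u\<close> in Int(R), and
  with it a power of \<open>f\<close>.\<close>

lemma min_val_eq_0:
  assumes p: "prime_elem p" and "normalize p \<notin> fixed_primes" and u: "u \<in> D"
  shows "min_val p u = 0"
proof (rule ccontr)
  assume "min_val p u \<noteq> 0"
  then have "int 1 \<le> val p (ev u c)" if "c \<in> nonroots" for c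
    using min_val_le[OF p u that] by linarith
  then have "[:\<iota> p:] \<in> D" using divide_const_in_Int[OF p u, of 1] by auto
  then show False using normalize_in_fixed_primes[OF p] assms(2) by blast
qed

text \<open>The minimum for \<open>h\<close> is reached at some \<open>t\<close> in
  \<open>T p\<close>, where the value of \<open>g * h\<close> exceeds it by
  \<open>val p (ev g t)\<close> only. So the finite set \<open>T p\<close> bounds all
  increments.\<close>

lemma finite_min_val_increments:
  assumes p: "prime_elem p" and g: "g \<in> D"
  shows "finite {min_val p (g * h) - min_val p h | h. h \<in> D}"
proof -
  have "\<exists>t\<in>T p. min_val p (g * h) - min_val p h \<le> nat (val p (ev g t))" if h: "h \<in> D" for h
  proof -
    have "\<exists>t\<in>T p. val p (ev h t) \<le> int (min_val p h)"
    proof (rule ccontr)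
      assume neg: "\<not> ?thesis"
      \<comment> \<open>If every point of \<open>T p\<close> missed the minimum, one more than the
        minimum would still be a lower bound at all nonroots.\<close>
      have "Suc (min_val p h) \<le> min_val p h"
      proof (rule le_min_val[OF p h])
        fix c assume "c \<in> nonroots"
        then obtain t where "t \<in> T p" "val p (ev h t) \<le> val p (ev h c)"
          using T_minimal[OF p] D_M[OF h] by blast
        then show "int (Suc (min_val p h)) \<le> val p (ev h c)" using neg by force
      qed
      then show False by simp
    qed
    then obtain t where t: "t \<in> T p" "val p (ev h t) \<le> int (min_val p h)" by blast
    have tn: "t \<in> nonroots" using T_subset[OF p t(1)] .
    have "int (min_val p (g * h)) \<le> val p (ev g t) + val p (ev h t)"
      using min_val_le[OF p D_mult[OF g h] tn] val_ev_mult[OF p D_M[OF g] D_M[OF h] tn] by simp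
    then show ?thesis using t by (intro bexI[of _ t]) auto
  qed
  then have "{min_val p (g * h) - min_val p h | h. h \<in> D} \<subseteq> (\<Union>t\<in>T p. {..nat (val p (ev g t))})"
    by fastforce
  then show ?thesis using finite_T[OF p] by (elim finite_subset) simp
qed

lemma W_const_le_one:
  assumes w: "w \<in> W" and p: "p \<in> fixed_primes"
  shows "w (to_fract [:\<iota> p:]) \<le> 1"
proof -
  have pe: "prime_elem p" using fixed_prime_elem[OF p] .
  then have p0: "p \<noteq> 0" by auto
  from w show ?thesis
  proof (cases rule: W_cases)
    case (1 g)
    then show ?thesis
      using fract_val_to_fract[of g "[:\<iota> p:]"] poly_val_const[of g "\<iota> p"] G_irreducible[OF 1(1)] p0 
        hom_eq_zero_iff by simp
  next
    case (2 q t)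
    have qe: "prime_elem q" using fixed_prime_elem[OF 2(1)] .
    have "multiplicity q p \<le> 1"
      using pe prime_multiplicity_other[of q p] 2(1) p by (cases "q = p") (auto simp: fixed_primes_def)
    then show ?thesis using point_val_const[OF qe T_subset[OF qe 2(2)] p0] 2(3) by simp
  qed
qed

text \<open>The element \<open>h\<close> is a high power of an element on which \<open>point_val p t\<close> vanishes while all other
  essential valuations are positive; it moves the minimum defining the fixed divisor of \<open>g h\<close> to
  the point \<open>t\<close>.\<close>

lemma exists_min_val_increment:
  assumes p: "p \<in> fixed_primes" and t: "t \<in> T p" and w: "point_val p t \<in> V" and g: "g \<in> D"
  shows "\<exists>h\<in>D. val p (ev g t) \<le> int (min_val p (g * h) - min_val p h)"
proof -
  have pe: "prime_elem p" using fixed_prime_elem[OF p] .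
  have tn: "t \<in> nonroots" using T_subset[OF pe t] .
  obtain y where y: "y \<in> H" "point_val p t y = 0" "\<And>w'. w' \<in> V - {point_val p t} \<Longrightarrow> 0 < w' y"
    using V.separating_element[OF w] by blast
  \<comment> \<open>The increment to be reached. Elsewhere in \<open>V\<close> the value of
    \<open>y\<close> is at least 1 and that of \<open>p\<close> at most 1, so \<open>y ^ m\<close>
    outweighs \<open>p ^ m\<close>.\<close>
  define m where "m = nat (val p (ev g t))"
  have m: "int m = val p (ev g t)" unfolding m_def using val_ev_nonneg[OF pe g tn] by simp
  have "y ^ m \<in> H" using V.H_power[OF y(1)] .
  then obtain h where h: "h \<in> D" "y ^ m = to_fract h" by (elim H_cases)
  define a where "a = to_fract [:\<iota> p:]"
  have aD: "[:\<iota> p:] \<in> D" using p unfolding fixed_primes_def by blast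
  then have aL: "a \<in> L" unfolding a_def by (rule L_to_fract)
  \<comment> \<open>Membership of \<open>x\<close> in the monoid means that \<open>p ^ m\<close>
    divides \<open>g * h\<close> in Int(R). At \<open>point_val p t\<close> the factors contribute
    \<open>m\<close>, 0 and \<open>- m\<close>.\<close>
  define x where "x = to_fract g * y ^ m * inverse (a ^ m)"
  have gL: "to_fract g \<in> L" and yL: "y \<in> L" using L_to_fract[OF g] V.H_subset_L[OF y(1)] by auto
  have xL: "x \<in> L" unfolding x_def using gL yL aL by (intro V.L_mult V.L_power V.L_inverse)
  have wx: "w' x = w' (to_fract g) + int m * w' y - int m * w' a" if "w' \<in> V" for w'
    unfolding x_def using that gL yL aL
    by (simp add: V.hom V.L_mult V.L_power V.L_inverse V.val_power V.val_inverse)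
  have "0 \<le> w' x" if w': "w' \<in> V" for w'
  proof (cases "w' = point_val p t")
    case True
    have "w' a = 1" unfolding a_def True using point_val_const[OF pe tn, of p] pe by auto
    moreover have "w' (to_fract g) = int m" unfolding True m using point_val_to_fract[OF pe tn D_M[OF g]] .
    ultimately show ?thesis using wx[OF w'] y(2) True by simp
  next
    case False
    then have "1 \<le> w' y" using y(3) w' by force
    moreover have "w' a \<le> 1" unfolding a_def using W_const_le_one[OF V_subset_W[OF w'] p] .
    ultimately have "int m * w' a \<le> int m * w' y" by (intro mult_left_mono) auto
    moreover have "0 \<le> w' (to_fract g)" using W_nonneg[OF V_subset_W[OF w']] g to_fract_in_H_iff by simp
    ultimately show ?thesis using wx[OF w'] by simp
  qed
  then have "x \<in> H" using V.in_iff[OF xL] by blast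
  then obtain z where z: "z \<in> D" "x = to_fract z" by (elim H_cases)
  have "a \<noteq> 0" using L_nonzero[OF aL] .
  then have "x * a ^ m = to_fract g * to_fract h" unfolding x_def h(2) by simp
  moreover have "a ^ m = to_fract ([:\<iota> p:] ^ m)" unfolding a_def by (induction m) (simp_all flip: to_fract_mult)
  ultimately have "to_fract (z * [:\<iota> p:] ^ m) = to_fract (g * h)" using z(2) by simp
  then have gh: "g * h = z * [:\<iota> p:] ^ m" by (simp only: to_fract_eq_iff)
  have "m \<le> min_val p (g * h)"
  proof (rule le_min_val[OF pe D_mult[OF g h(1)]])
    fix c assume c: "c \<in> nonroots"
    have p0: "\<iota> p \<noteq> 0" using pe hom_eq_zero_iff by auto
    have "val p (\<iota> p) = 1" using val_hom[OF pe, of p] pe by auto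
    then have "val p (ev ([:\<iota> p:] ^ m) c) = int m" using val_power[OF pe p0, of m] by (simp add: poly_power)
    then show "int m \<le> val p (ev (g * h) c)"
      using gh val_ev_mult[OF pe D_M[OF z(1)] D_M[OF D_power[OF aD]] c] val_ev_nonneg[OF pe z(1) c] by simp
  qed
  \<comment> \<open>The value of \<open>h\<close> at \<open>t\<close> is prime to \<open>p\<close>,
    so all of \<open>m\<close> counts as increment.\<close>
  moreover have "min_val p h = 0"
  proof -
    have "val p (ev h t) = point_val p t (y ^ m)"
      using point_val_to_fract[OF pe tn D_M[OF h(1)]] h(2) by simp
    also have "\<dots> = 0" using V.val_power[OF w yL] y(2) by simp
    finally show ?thesis using min_val_le[OF pe h(1) tn] by simp
  qed
  ultimately show ?thesis using h(1) m by (intro bexI[of _ h]) auto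
qed

section \<open>Multiplicities in d and e_f\<close>

lemma finite_fixed_representatives:
  assumes \<Q>: "prime_representatives \<Q>"
  shows "finite {p \<in> \<Q>. normalize p \<in> fixed_primes}"
proof (rule inj_on_finite[OF _ _ finite_fixed_primes])
  show "inj_on normalize {p \<in> \<Q>. normalize p \<in> fixed_primes}"
  proof (rule inj_onI)
    fix p q assume "p \<in> {p \<in> \<Q>. normalize p \<in> fixed_primes}" "q \<in> {p \<in> \<Q>. normalize p \<in> fixed_primes}"
      "normalize p = normalize q"
    then show "p = q" using prime_representatives_dvd_imp_eq[OF \<Q>, of p q] by (simp add: associated_iff_dvd)
  qed
qed auto

text \<open>The fixed divisor of \<open>h\<close> divides that of \<open>g * h\<close> exponent by
  exponent, so \<open>div\<close> is exact and the subtraction is not truncated.\<close>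

lemma multiplicity_fixed_div_quotient:
  assumes \<Q>: "prime_representatives \<Q>" and p: "p \<in> \<Q>" and g: "g \<in> D" and h: "h \<in> D"
  shows "multiplicity p (fixed_div \<iota> \<Q> (g * h) div fixed_div \<iota> \<Q> h)
    = min_val p (g * h) - min_val p h"
proof -
  define S where "S = {p \<in> \<Q>. normalize p \<in> fixed_primes}"
  have pe: "prime_elem q" if "q \<in> \<Q>" for q using \<Q> that unfolding prime_representatives_def by blast
  have S: "finite S" "S \<subseteq> \<Q>" unfolding S_def using finite_fixed_representatives[OF \<Q>] by auto
  have supp: "q \<in> S" if "q \<in> \<Q>" "min_val q u \<noteq> 0" "u \<in> D" for q u
    using min_val_eq_0[OF pe[OF that(1)] _ that(3)] that unfolding S_def by blast
  have fd: "fixed_div \<iota> \<Q> u = fin_prime_prod \<Q> (\<lambda>p. min_val p u)" for u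
    unfolding fixed_div_def min_val_def ..
  have eq: "fixed_div \<iota> \<Q> u = (\<Prod>q\<in>S. q ^ min_val q u)" if "u \<in> D" for u
    unfolding fd using supp that by (intro fin_prime_prod_eq[OF S]) blast
  have nz: "fixed_div \<iota> \<Q> u \<noteq> 0" if "u \<in> D" for u
    unfolding eq[OF that] using S pe[of 0] by auto
  have mult: "multiplicity p (fixed_div \<iota> \<Q> u) = min_val p u" if u: "u \<in> D" for u
  proof -
    have "{q \<in> \<Q>. min_val q u \<noteq> 0} \<subseteq> S" using supp[OF _ _ u] by blast
    then have "finite {q \<in> \<Q>. min_val q u \<noteq> 0}" using S(1) finite_subset by blast
    then show ?thesis unfolding fd by (rule multiplicity_fin_prime_prod[OF \<Q> _ p])
  qed
  have "fixed_div \<iota> \<Q> h dvd fixed_div \<iota> \<Q> (g * h)"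
    unfolding eq[OF h] eq[OF D_mult[OF g h]] using min_val_mult_ge[OF pe g h] S(2)
    by (intro prod_dvd_prod le_imp_power_dvd) blast
  then obtain e where e: "fixed_div \<iota> \<Q> (g * h) = fixed_div \<iota> \<Q> h * e" by (elim dvdE)
  then have "e \<noteq> 0" using nz[OF D_mult[OF g h]] by auto
  then have "min_val p (g * h) = min_val p h + multiplicity p e"
    using prime_elem_multiplicity_mult_distrib[OF pe[OF p] nz[OF h], of e] mult[OF h] mult[OF D_mult[OF g h]] e
    by simp
  then show ?thesis using e nz[OF h] by simp
qed

text \<open>At representatives of primes that are not fixed all increments vanish. So the product
  defining \<open>e_fun\<close> has finite support and its exponents can be read off.\<close>

lemma multiplicity_e_fun:
  assumes \<Q>: "prime_representatives \<Q>" and p: "p \<in> \<Q>" and g: "g \<in> D"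
  shows "multiplicity p (e_fun \<iota> \<Q> f g) = Max {min_val p (g * h) - min_val p h | h. h \<in> D}"
proof -
  define E where "E q = (\<lambda>h. min_val q (g * h) - min_val q h) ` D" for q
  have pe: "prime_elem q" if "q \<in> \<Q>" for q using \<Q> that unfolding prime_representatives_def by blast
  have E: "{multiplicity q (fixed_div \<iota> \<Q> (g * h) div fixed_div \<iota> \<Q> h) | h. h \<in> D} = E q"
    if "q \<in> \<Q>" for q
    unfolding E_def Setcompr_eq_image
    using multiplicity_fixed_div_quotient[OF \<Q> that g] by (intro image_cong) auto
  have zero: "Max (E q) = 0" if q: "q \<in> \<Q>" "normalize q \<notin> fixed_primes" for q
  proof -
    have "min_val q u = 0" if "u \<in> D" for u using min_val_eq_0[OF pe[OF q(1)] q(2) that] .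
    then have "E q = (\<lambda>_. 0) ` D" unfolding E_def using D_mult[OF g] by (intro image_cong) auto
    also have "\<dots> = {0}" using one_in_D by auto
    finally have "E q = {0}" .
    then show ?thesis by simp
  qed
  have "{q \<in> \<Q>. Max {multiplicity q (fixed_div \<iota> \<Q> (g * h) div fixed_div \<iota> \<Q> h) | h. h \<in> D} \<noteq> 0}
      \<subseteq> {q \<in> \<Q>. normalize q \<in> fixed_primes}"
    using E zero by (metis (mono_tags, lifting) mem_Collect_eq subsetI)
  then have "finite {q \<in> \<Q>. Max {multiplicity q (fixed_div \<iota> \<Q> (g * h) div fixed_div \<iota> \<Q> h) | h. h \<in> D} \<noteq> 0}"
    using finite_fixed_representatives[OF \<Q>] finite_subset by blast
  from multiplicity_fin_prime_prod[OF \<Q> this p] show ?thesis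
    unfolding e_fun_def using E[OF p] by (simp add: E_def Setcompr_eq_image)
qed

text \<open>\<open>Q\<close> belongs to an essential valuation that is positive on the constant
  \<open>q\<close>, which excludes the valuations of polynomials. It is thus
  \<open>point_val p t\<close> with \<open>p\<close> associated to \<open>q\<close>, and its value
  at \<open>g\<close> is at most one of the increments whose maximum is the exponent in
  \<open>e_fun\<close>.\<close>

lemma v_exponent_le_multiplicity_e_fun:
  assumes \<Q>: "prime_representatives \<Q>" and g: "g \<in> D" and Q: "Q \<in> min_primes H"
    and q: "irreducible q" "to_fract [:\<iota> q:] \<in> Q"
  shows "v_exponent H Q ({to_fract g} * H) \<le> int (multiplicity q (e_fun \<iota> \<Q> f g))"
proof -
  obtain w where w: "w \<in> V" "Q = V.val_prime w" using Q V.min_primes_eq by blast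
  have pos: "0 < w (to_fract [:\<iota> q:])" using q(2) w(2) unfolding V.val_prime_def by blast
  have qe: "prime_elem q" using q(1) by (simp add: prime_elem_iff_irreducible)
  then have q0: "q \<noteq> 0" by auto
  obtain p t where p: "p \<in> fixed_primes" "t \<in> T p" "w = point_val p t"
    using V_subset_W[OF w(1)]
  proof (cases rule: W_cases)
    case (1 b)
    then have "w (to_fract [:\<iota> q:]) = 0"
      using fract_val_to_fract[of b "[:\<iota> q:]"] poly_val_const[of b "\<iota> q"] G_irreducible[OF 1(1)] q0
        hom_eq_zero_iff by simp
    with pos show ?thesis by simp
  qed
  have pe: "prime_elem p" using fixed_prime_elem[OF p(1)] .
  have tn: "t \<in> nonroots" using T_subset[OF pe p(2)] .
  have "0 < multiplicity p q" using pos point_val_const[OF pe tn q0] p(3) by simp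
  then have "p dvd q" using not_dvd_imp_multiplicity_0 by fastforce
  then have "p dvd normalize q" by simp
  then have pq: "p = normalize q" 
    using p(1) qe by (intro primes_dvd_imp_eq) (auto simp: fixed_primes_def)
  \<comment> \<open>Three associated primes occur: the given \<open>q\<close>, the normalized
    \<open>p\<close> of the valuation and the representative \<open>r\<close> through which
    \<open>e_fun\<close> is defined. Their multiplicities agree.\<close>
  obtain r where r: "r \<in> \<Q>" "r dvd q" "q dvd r"
    using \<Q> qe unfolding prime_representatives_def by blast
  then have "normalize r = normalize q" by (simp add: associated_iff_dvd)
  then have mult: "multiplicity q x = multiplicity r x" "multiplicity p x = multiplicity r x" for x
    using pq by (metis multiplicity_normalize_left)+
  have re: "prime_elem r" using \<Q> r(1) unfolding prime_representatives_def by blast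
  obtain h where h: "h \<in> D" "val p (ev g t) \<le> int (min_val p (g * h) - min_val p h)"
    using exists_min_val_increment[OF p(1,2) _ g] w(1) p(3) by blast
  have "min_val r (g * h) - min_val r h \<le> Max {min_val r (g * h) - min_val r h | h. h \<in> D}"
    using finite_min_val_increments[OF re g] h(1) by (intro Max_ge) auto
  also have "\<dots> = multiplicity q (e_fun \<iota> \<Q> f g)" using multiplicity_e_fun[OF \<Q> r(1) g] mult(1) by simp
  finally have "min_val p (g * h) - min_val p h \<le> multiplicity q (e_fun \<iota> \<Q> f g)"
    using min_val_cong[of p r, OF mult(2)] by simp
  moreover have "v_exponent H Q ({to_fract g} * H) = val p (ev g t)"
    using V.v_exponent_principal[OF w(1) L_to_fract[OF g]] w(2) p(3)
      point_val_to_fract[OF pe tn D_M[OF g]] by simp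
  ultimately show ?thesis using h(2) by linarith
qed

end

theorem proposition3p9:
  fixes \<iota> :: "'a::{factorial_semiring,idom} \<Rightarrow> 'k::field"
    and f :: "'k poly"
    and \<Q> :: "'a set"
  assumes "quotient_field_embedding \<iota>"
    and "f \<noteq> 0" and "\<forall>n. coeff f n \<in> range \<iota>"
    and "prime_representatives \<Q>"
  shows
    "(\<forall>g \<in> div_closed \<iota> f. \<forall>h \<in> div_closed \<iota> f.
        v_closure (div_monoid \<iota> f) (P_ideal \<iota> f g * P_ideal \<iota> f h) = P_ideal \<iota> f (g * h)) \<and>
     (\<forall>g \<in> div_closed \<iota> f. irreducible g \<longrightarrow>
        (\<forall>x \<in> quotient_group (div_monoid \<iota> f).
           v_exponent (div_monoid \<iota> f) (P_ideal \<iota> f g) ({x} * div_monoid \<iota> f) = fract_val g x)) \<and>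
     (\<forall>g \<in> div_closed \<iota> f. \<forall>Q \<in> min_primes (div_monoid \<iota> f). \<forall>q.
        irreducible q \<and> to_fract [:\<iota> q:] \<in> Q \<longrightarrow>
          v_exponent (div_monoid \<iota> f) Q ({to_fract g} * div_monoid \<iota> f)
            \<le> int (multiplicity q (e_fun \<iota> \<Q> f g)))"
proof -
  interpret integer_valued_divisors \<iota> f
    by unfold_locales (fact assms)+
  show ?thesis
  proof (intro conjI ballI allI impI)
    fix g h assume "g \<in> D" "h \<in> D"
    then show "v_closure H (P_ideal \<iota> f g * P_ideal \<iota> f h) = P_ideal \<iota> f (g * h)"
      by (rule v_closure_P_ideal_mult)
  next
    fix g x assume "g \<in> D" "irreducible g" "x \<in> L"
    then show "v_exponent H (P_ideal \<iota> f g) ({x} * H) = fract_val g x"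
      by (rule v_exponent_P_ideal)
  next
    fix g Q q assume "g \<in> D" "Q \<in> min_primes H" "irreducible q \<and> to_fract [:\<iota> q:] \<in> Q"
    then show "v_exponent H Q ({to_fract g} * H) \<le> int (multiplicity q (e_fun \<iota> \<Q> f g))"
      using v_exponent_le_multiplicity_e_fun[OF assms(4)] by simp
  qed
qed

end
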